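(* There is an algorithm that, given a directed acyclic multigraph $G$ with single source $s$ and single sink $t$ and a non-negative integer flow $f$ on $G$ with $f(e)>0$ for all edges $e$, outputs a flow decomposition of $(G,f)$ with non-negative integer weights whose size is at most $\frac{\mathrm{pw}(G)}{\mathrm{width}(G)}\cdot(\lfloor\log\Vert f\Vert\rfloor+1)\cdot\mathrm{MFD}_{\mathbb{N}}(G,f)$, in time $O(n\log\Vert f\Vert\cdot(\mathrm{pw}(G)+m))$. Moreover, if $\mathrm{MFD}_{\mathbb{N}}(G,f)\ge \mathrm{pw}(G)$, the output has size at most $(\lfloor\log\Vert f\Vert\rfloor+1)\cdot\mathrm{MFD}_{\mathbb{N}}(G,f)$.
   Context: Graphs are directed acyclic multigraphs with single source $s$ and single sink $t$, every edge on some $s$-$t$ path; $n=|V(G)|$, $m=|E(G)|$. A flow is $f:E(G)\to\mathbb{N}$ with conservation at vertices other than $s,t$; $\Vert f\Vert=\max_e f(e)$; $\log$ is base 2. A flow decomposition of size $k$ of $(G,f)$ is a family of $s$-$t$ paths $P_1,\dots,P_k$ and weights $w_1,\dots,w_k\in\mathbb{N}$ with $f=\sum_i w_iP_i$ (paths as edge-indicator functions); $\mathrm{MFD}_{\mathbb{N}}(G,f)$ is the minimum size. $\mathrm{width}(G)$ is the minimum number of $s$-$t$ paths covering all edges. A cut-set is a set of edges whose removal disconnects $s$ from $t$; the parallel-width $\mathrm{pw}(G)$ is the largest size of an inclusion-minimal cut-set. *)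

theory Defs
  imports Complex_Main "Graph_Theory.Digraph" "Graph_Theory.Arc_Walk"
begin

section \<open>Flows and flow decompositions in s-t DAGs\<close>

text \<open>
  Multigraphs are the digraphs with explicit arcs of the Graph Theory library, so parallel arcs
  are allowed. A graph without arcs is excluded, since the maximum flow value is undefined there.
\<close>

definition st_dag :: "('a, 'b) pre_digraph \<Rightarrow> 'a \<Rightarrow> 'a \<Rightarrow> bool" where
  "st_dag G s t \<longleftrightarrow>
     fin_digraph G \<and> arcs G \<noteq> {} \<and> acyclic (arcs_ends G) \<and>
     {v \<in> verts G. in_degree G v = 0} = {s} \<and>
     {v \<in> verts G. out_degree G v = 0} = {t} \<and>
     (\<forall>e \<in> arcs G. \<exists>p. pre_digraph.apath G s p t \<and> e \<in> set p)"

definition is_flow :: "('a, 'b) pre_digraph \<Rightarrow> 'a \<Rightarrow> 'a \<Rightarrow> ('b \<Rightarrow> nat) \<Rightarrow> bool" where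
  "is_flow G s t f \<longleftrightarrow>
     (\<forall>v \<in> verts G - {s, t}. (\<Sum>e \<in> in_arcs G v. f e) = (\<Sum>e \<in> out_arcs G v. f e))"

definition flow_norm :: "('a, 'b) pre_digraph \<Rightarrow> ('b \<Rightarrow> nat) \<Rightarrow> nat" where
  "flow_norm G f = Max (f ` arcs G)"

definition flow_decomposition ::
  "('a, 'b) pre_digraph \<Rightarrow> 'a \<Rightarrow> 'a \<Rightarrow> ('b \<Rightarrow> nat) \<Rightarrow> ('b list \<times> nat) list \<Rightarrow> bool" where
  "flow_decomposition G s t f D \<longleftrightarrow>
     (\<forall>(p, w) \<in> set D. pre_digraph.apath G s p t) \<and>
     (\<forall>e \<in> arcs G. f e = (\<Sum>(p, w) \<leftarrow> D. w * of_bool (e \<in> set p)))"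

definition mfd :: "('a, 'b) pre_digraph \<Rightarrow> 'a \<Rightarrow> 'a \<Rightarrow> ('b \<Rightarrow> nat) \<Rightarrow> nat" where
  "mfd G s t f = (LEAST k. \<exists>D. flow_decomposition G s t f D \<and> length D = k)"

definition width :: "('a, 'b) pre_digraph \<Rightarrow> 'a \<Rightarrow> 'a \<Rightarrow> nat" where
  "width G s t =
     (LEAST k. \<exists>ps. (\<forall>p \<in> set ps. pre_digraph.apath G s p t) \<and>
                     arcs G \<subseteq> (\<Union>p \<in> set ps. set p) \<and> length ps = k)"

definition cut_set :: "('a, 'b) pre_digraph \<Rightarrow> 'a \<Rightarrow> 'a \<Rightarrow> 'b set \<Rightarrow> bool" where
  "cut_set G s t X \<longleftrightarrow> X \<subseteq> arcs G \<and> \<not> reachable (G\<lparr>arcs := arcs G - X\<rparr>) s t"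

definition minimal_cut_set :: "('a, 'b) pre_digraph \<Rightarrow> 'a \<Rightarrow> 'a \<Rightarrow> 'b set \<Rightarrow> bool" where
  "minimal_cut_set G s t X \<longleftrightarrow> cut_set G s t X \<and> (\<forall>Y. Y \<subset> X \<longrightarrow> \<not> cut_set G s t Y)"

definition parallel_width :: "('a, 'b) pre_digraph \<Rightarrow> 'a \<Rightarrow> 'a \<Rightarrow> nat" where
  "parallel_width G s t = Max (card ` {X. minimal_cut_set G s t X})"


section \<open>Word RAM programs and their running time\<close>

text \<open>
  Algorithms are programs of a deterministic imperative language over finitely many registers and
  arrays of natural numbers, i.e. structured word RAM programs. The instruction set is addition,
  truncated subtraction, halving, comparison, and indirect reading and writing; multiplication is
  not a unit-cost instruction. Every evaluated node of an expression costs one time unit, and so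
  does every executed command. All values that occur, including array indices and intermediate
  results, must be below the word capacity \<open>B\<close>; otherwise the execution is stuck.
\<close>

datatype aexp =
    Const nat
  | Reg string
  | Cell string aexp
  | Plus aexp aexp
  | Minus aexp aexp
  | Half aexp

datatype bexp =
    Less aexp aexp
  | Equal aexp aexp
  | Neg bexp
  | Conj bexp bexp

datatype com =
    Skip
  | Assign string aexp
  | Store string aexp aexp
  | Seq com com
  | Cond bexp com com
  | While bexp com

record state =
  reg :: "string \<Rightarrow> nat"
  arr :: "string \<Rightarrow> nat \<Rightarrow> nat"

primrec aval :: "aexp \<Rightarrow> state \<Rightarrow> nat" where
  "aval (Const c) \<sigma> = c"
| "aval (Reg x) \<sigma> = reg \<sigma> x"
| "aval (Cell a i) \<sigma> = arr \<sigma> a (aval i \<sigma>)"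
| "aval (Plus a b) \<sigma> = aval a \<sigma> + aval b \<sigma>"
| "aval (Minus a b) \<sigma> = aval a \<sigma> - aval b \<sigma>"
| "aval (Half a) \<sigma> = aval a \<sigma> div 2"

primrec bval :: "bexp \<Rightarrow> state \<Rightarrow> bool" where
  "bval (Less a b) \<sigma> \<longleftrightarrow> aval a \<sigma> < aval b \<sigma>"
| "bval (Equal a b) \<sigma> \<longleftrightarrow> aval a \<sigma> = aval b \<sigma>"
| "bval (Neg b) \<sigma> \<longleftrightarrow> \<not> bval b \<sigma>"
| "bval (Conj b c) \<sigma> \<longleftrightarrow> bval b \<sigma> \<and> bval c \<sigma>"

primrec afits :: "nat \<Rightarrow> aexp \<Rightarrow> state \<Rightarrow> bool" where
  "afits B (Const c) \<sigma> \<longleftrightarrow> c < B"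
| "afits B (Reg x) \<sigma> \<longleftrightarrow> reg \<sigma> x < B"
| "afits B (Cell a i) \<sigma> \<longleftrightarrow> afits B i \<sigma> \<and> arr \<sigma> a (aval i \<sigma>) < B"
| "afits B (Plus a b) \<sigma> \<longleftrightarrow> afits B a \<sigma> \<and> afits B b \<sigma> \<and> aval a \<sigma> + aval b \<sigma> < B"
| "afits B (Minus a b) \<sigma> \<longleftrightarrow> afits B a \<sigma> \<and> afits B b \<sigma>"
| "afits B (Half a) \<sigma> \<longleftrightarrow> afits B a \<sigma>"

primrec bfits :: "nat \<Rightarrow> bexp \<Rightarrow> state \<Rightarrow> bool" where
  "bfits B (Less a b) \<sigma> \<longleftrightarrow> afits B a \<sigma> \<and> afits B b \<sigma>"
| "bfits B (Equal a b) \<sigma> \<longleftrightarrow> afits B a \<sigma> \<and> afits B b \<sigma>"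
| "bfits B (Neg b) \<sigma> \<longleftrightarrow> bfits B b \<sigma>"
| "bfits B (Conj b c) \<sigma> \<longleftrightarrow> bfits B b \<sigma> \<and> bfits B c \<sigma>"

primrec acost :: "aexp \<Rightarrow> nat" where
  "acost (Const c) = 1"
| "acost (Reg x) = 1"
| "acost (Cell a i) = 1 + acost i"
| "acost (Plus a b) = 1 + acost a + acost b"
| "acost (Minus a b) = 1 + acost a + acost b"
| "acost (Half a) = 1 + acost a"

primrec bcost :: "bexp \<Rightarrow> nat" where
  "bcost (Less a b) = 1 + acost a + acost b"
| "bcost (Equal a b) = 1 + acost a + acost b"
| "bcost (Neg b) = 1 + bcost b"
| "bcost (Conj b c) = 1 + bcost b + bcost c"

text \<open>
  \<open>exec B c \<sigma> T \<tau>\<close>: started in \<open>\<sigma>\<close> with word capacity \<open>B\<close>, the program \<open>c\<close> terminates in \<open>\<tau>\<close>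
  after exactly \<open>T\<close> time units.
\<close>

inductive exec :: "nat \<Rightarrow> com \<Rightarrow> state \<Rightarrow> nat \<Rightarrow> state \<Rightarrow> bool" for B :: nat where
  Skip: "exec B Skip \<sigma> 1 \<sigma>"
| Assign: "afits B a \<sigma> \<Longrightarrow>
    exec B (Assign x a) \<sigma> (1 + acost a) (\<sigma>\<lparr>reg := (reg \<sigma>)(x := aval a \<sigma>)\<rparr>)"
| Store: "\<lbrakk>afits B i \<sigma>; afits B a \<sigma>\<rbrakk> \<Longrightarrow>
    exec B (Store x i a) \<sigma> (1 + acost i + acost a)
      (\<sigma>\<lparr>arr := (arr \<sigma>)(x := (arr \<sigma> x)(aval i \<sigma> := aval a \<sigma>))\<rparr>)"
| Seq: "\<lbrakk>exec B c \<sigma> T \<sigma>'; exec B d \<sigma>' T' \<sigma>''\<rbrakk> \<Longrightarrow> exec B (Seq c d) \<sigma> (1 + T + T') \<sigma>''"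
| CondTrue: "\<lbrakk>bfits B b \<sigma>; bval b \<sigma>; exec B c \<sigma> T \<sigma>'\<rbrakk> \<Longrightarrow>
    exec B (Cond b c d) \<sigma> (1 + bcost b + T) \<sigma>'"
| CondFalse: "\<lbrakk>bfits B b \<sigma>; \<not> bval b \<sigma>; exec B d \<sigma> T \<sigma>'\<rbrakk> \<Longrightarrow>
    exec B (Cond b c d) \<sigma> (1 + bcost b + T) \<sigma>'"
| WhileFalse: "\<lbrakk>bfits B b \<sigma>; \<not> bval b \<sigma>\<rbrakk> \<Longrightarrow> exec B (While b c) \<sigma> (1 + bcost b) \<sigma>"
| WhileTrue: "\<lbrakk>bfits B b \<sigma>; bval b \<sigma>; exec B c \<sigma> T \<sigma>'; exec B (While b c) \<sigma>' T' \<sigma>''\<rbrakk> \<Longrightarrow>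
    exec B (While b c) \<sigma> (1 + bcost b + T + T') \<sigma>''"

inductive_cases exec_SkipE: "exec B Skip \<sigma> T \<tau>"
inductive_cases exec_AssignE: "exec B (Assign x a) \<sigma> T \<tau>"
inductive_cases exec_StoreE: "exec B (Store x i a) \<sigma> T \<tau>"
inductive_cases exec_SeqE: "exec B (Seq c d) \<sigma> T \<tau>"
inductive_cases exec_CondE: "exec B (Cond b c d) \<sigma> T \<tau>"
inductive_cases exec_WhileE: "exec B (While b c) \<sigma> T \<tau>"

lemma exec_deterministic:
  "exec B c \<sigma> T \<tau> \<Longrightarrow> exec B c \<sigma> T' \<tau>' \<Longrightarrow> T' = T \<and> \<tau>' = \<tau>"
proof (induction arbitrary: T' \<tau>' rule: exec.induct)
  case (Skip \<sigma>)
  then show ?case by (rule exec_SkipE) simp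
next
  case (Assign a \<sigma> x)
  from Assign.prems show ?case by (rule exec_AssignE) simp
next
  case (Store i \<sigma> a x)
  from Store.prems show ?case by (rule exec_StoreE) simp
next
  case (Seq c \<sigma> T \<sigma>' d T2 \<sigma>'')
  from Seq.prems show ?case
  proof (rule exec_SeqE, goal_cases)
    case (1 U \<rho> U')
    from Seq.IH(1)[OF 1(2)] have "U = T" "\<rho> = \<sigma>'" by simp_all
    with 1(3) have "U' = T2" "\<tau>' = \<sigma>''" using Seq.IH(2) by blast+
    with 1(1) \<open>U = T\<close> show ?case by simp
  qed
next
  case (CondTrue b \<sigma> c T \<sigma>' d)
  from CondTrue.prems show ?case
    by (rule exec_CondE) (use CondTrue.hyps in \<open>auto dest: CondTrue.IH\<close>)
next
  case (CondFalse b \<sigma> d T \<sigma>' c)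
  from CondFalse.prems show ?case
    by (rule exec_CondE) (use CondFalse.hyps in \<open>auto dest: CondFalse.IH\<close>)
next
  case (WhileFalse b \<sigma> c)
  from WhileFalse.prems show ?case
    by (rule exec_WhileE) (use WhileFalse.hyps in simp_all)
next
  case (WhileTrue b \<sigma> c T \<sigma>' T2 \<sigma>'')
  from WhileTrue.prems show ?case
  proof (rule exec_WhileE, goal_cases)
    case 1
    with WhileTrue.hyps show ?case by simp
  next
    case (2 U \<rho> U')
    from WhileTrue.IH(1)[OF 2(4)] have "U = T" "\<rho> = \<sigma>'" by simp_all
    with 2(5) have "U' = T2" "\<tau>' = \<sigma>''" using WhileTrue.IH(2) by blast+
    with 2(1) \<open>U = T\<close> show ?case by simp
  qed
qed


section \<open>Input and output conventions\<close>

text \<open>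
  An input graph has vertices \<open>0, \<dots>, n - 1\<close> and arcs \<open>0, \<dots>, m - 1\<close>, numbered arbitrarily, and is
  given as an arc list. All memory that does not hold the input is zero.
\<close>

definition numbered :: "(nat, nat) pre_digraph \<Rightarrow> bool" where
  "numbered G \<longleftrightarrow> verts G = {..<card (verts G)} \<and> arcs G = {..<card (arcs G)}"

definition input_state :: "(nat, nat) pre_digraph \<Rightarrow> nat \<Rightarrow> nat \<Rightarrow> (nat \<Rightarrow> nat) \<Rightarrow> state" where
  "input_state G s t f =
     \<lparr>reg = (\<lambda>_. 0)(''n'' := card (verts G), ''m'' := card (arcs G), ''s'' := s, ''t'' := t),
      arr = (\<lambda>_ _. 0)(''tail'' := (\<lambda>e. if e \<in> arcs G then tail G e else 0),
                      ''head'' := (\<lambda>e. if e \<in> arcs G then head G e else 0),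
                      ''flow'' := (\<lambda>e. if e \<in> arcs G then f e else 0))\<rparr>"

text \<open>
  The output consists of \<open>k\<close> weighted arc lists. The lists are stored consecutively in the array
  \<open>path\<close>, the \<open>i\<close>-th one in the positions from \<open>start[i]\<close> to \<open>start[i + 1] - 1\<close>.
\<close>

definition program_output :: "state \<Rightarrow> (nat list \<times> nat) list" where
  "program_output \<sigma> =
     map (\<lambda>i. (map (arr \<sigma> ''path'') [arr \<sigma> ''start'' i ..< arr \<sigma> ''start'' (Suc i)],
               arr \<sigma> ''weight'' i))
       [0..<reg \<sigma> ''k'']"

end

theory Submission
  imports Defs
begin

text \<open>
  Write \<open>f = f' + 2 g\<close>, where \<open>g\<close> is a blocking flow for the capacities \<open>\<lfloor>f / 2\<rfloor>\<close>. Every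
  path from \<open>s\<close> to \<open>t\<close> then has an arc with \<open>f' \<le> 1\<close>, so these arcs contain a minimal cut-set. It
  is crossed by the whole of \<open>f'\<close>, which therefore has value at most the parallel-width and splits
  into that many paths of weight one. Recursing on \<open>g\<close> with doubled weights stops after
  \<open>\<lfloor>log \<parallel>f\<parallel>\<rfloor> + 1\<close> rounds. The size bounds follow because the paths of any decomposition of a positive
  flow cover all arcs, so that the width is at most the minimum size of a decomposition.

  The blocking flow is found by walks from the source. Each vertex keeps a pointer that only moves
  forward, and every augmentation either empties an arc or lowers the value of the flow. Since
  the bound leaves time \<open>O(n m)\<close> per round, the pointers may scan the list of all arcs, and no adjacency
  lists are needed.
\<close>

section \<open>Flows and cuts in s-t DAGs\<close>

text \<open>The same search runs twice per round. With a limit that never binds it computes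
  \<open>g\<close>; with limit 1 it splits \<open>f'\<close> into unit paths. As \<open>f'\<close>
  is itself a flow, its residual vanishes once it is blocked, so the unit paths exhaust it. Only the
  measure bounding the number of augmentations differs: nonempty arcs for \<open>g\<close>, the flow
  value for \<open>f'\<close>. That value is at most the parallel-width and hence at most
  \<open>m\<close>, so both searches stay within time O(n m).

  The bound \<open>f' \<le> 1\<close> comes from parity: where \<open>g\<close> uses up the capacity
  \<open>f div 2\<close>, the remainder \<open>f - 2 g\<close> is \<open>f mod 2\<close>. The arcs
  with this property may be far more than the parallel-width, but conservation pushes the whole
  value through every cut, in particular through a minimal cut-set inside them.

  Each round adds at most one parallel-width of paths. The factor MFD / width is at least 1, which
  gives the stated ratio. Besides the running time, all array positions have to be bounded, since
  indices must stay below the word capacity.\<close>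

locale st_network =
  fixes G :: "('a, 'b) pre_digraph" and s t :: 'a
  assumes st_dag: "st_dag G s t"
begin

sublocale fin_digraph G
  using st_dag by (simp add: st_dag_def)

definition val :: "('b \<Rightarrow> nat) \<Rightarrow> nat" where
  "val g = (\<Sum>e\<in>out_arcs G s. g e)"

definition leaving :: "'a set \<Rightarrow> 'b set" where
  "leaving R = {e \<in> arcs G. tail G e \<in> R \<and> head G e \<notin> R}"

text \<open>A vertex set that no arc of positive capacity leaves replaces a statement about all s-t
  paths: the search yields such a set directly, and flow bounds apply to it.\<close>

definition blocked :: "('b \<Rightarrow> nat) \<Rightarrow> bool" where
  "blocked c \<longleftrightarrow> (\<exists>R \<subseteq> verts G. s \<in> R \<and> t \<notin> R \<and> (\<forall>e \<in> leaving R. c e = 0))"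

section \<open>Elementary properties of s-t DAGs\<close>

lemma arcs_nonempty: "arcs G \<noteq> {}"
  and acyclic_ends: "acyclic (arcs_ends G)"
  using st_dag by (auto simp: st_dag_def)

lemma source: "s \<in> verts G" "in_arcs G s = {}"
proof -
  have "s \<in> {v \<in> verts G. in_degree G v = 0}"
    using st_dag by (auto simp: st_dag_def)
  then show "s \<in> verts G" "in_arcs G s = {}"
    by (auto simp: in_degree_def finite_in_arcs)
qed

lemma sink: "t \<in> verts G" "out_arcs G t = {}"
proof -
  have "t \<in> {v \<in> verts G. out_degree G v = 0}"
    using st_dag by (auto simp: st_dag_def)
  then show "t \<in> verts G" "out_arcs G t = {}"
    by (auto simp: out_degree_def finite_out_arcs)
qed

lemma in_arcs_nonempty: "v \<in> verts G \<Longrightarrow> v \<noteq> s \<Longrightarrow> in_arcs G v \<noteq> {}"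
proof
  assume v: "v \<in> verts G" "v \<noteq> s" "in_arcs G v = {}"
  then have "v \<in> {v \<in> verts G. in_degree G v = 0}" by (simp add: in_degree_def)
  with v st_dag show False by (auto simp: st_dag_def)
qed

text \<open>A repeated vertex would enclose a nonempty closed walk, which acyclicity forbids. The
  walks built by the search are therefore paths.\<close>

lemma awalk_imp_apath:
  assumes "awalk u p v"
  shows "apath u p v"
proof (rule ccontr)
  assume "\<not> apath u p v"
  then have "\<not> distinct (awalk_verts u p)" using assms by (simp add: apath_def)
  then obtain w r where "awalk w r w" "r \<noteq> []"
    using awalk_not_distinct_decomp[OF assms] by auto
  then have "(w, w) \<in> (arcs_ends G)\<^sup>+" using reachable1_awalk by blast
  then show False using acyclic_ends by (simp add: acyclic_def)
qed

lemma apath_distinct: "apath u p v \<Longrightarrow> distinct p"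
  by (auto simp: apath_def intro: distinct_verts_imp_distinct)

lemma source_neq_sink: "s \<noteq> t"
proof
  assume "s = t"
  obtain e where e: "e \<in> arcs G" using arcs_nonempty by blast
  then obtain p where "apath s p t" "e \<in> set p" using st_dag unfolding st_dag_def by blast
  moreover have "p = []" using \<open>apath s p t\<close> \<open>s = t\<close>
    by (metis apath_ends)
  ultimately show False by simp
qed

lemma card_verts_ge: "card (verts G) \<ge> 2"
proof -
  have "card {s, t} \<le> card (verts G)"
    using source(1) sink(1) by (intro card_mono) auto
  then show ?thesis using source_neq_sink by simp
qed

lemma card_arcs_ge: "card (arcs G) \<ge> 1"
  using arcs_nonempty by (simp add: Suc_le_eq card_gt_0_iff)

text \<open>Each vertex other than \<open>s\<close> is the head of some arc. This later absorbs
  terms of order \<open>n * n\<close> into \<open>n * m\<close>.\<close>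

lemma card_verts_le: "card (verts G) \<le> card (arcs G) + 1"
proof -
  have "verts G - {s} \<subseteq> head G ` arcs G"
    using in_arcs_nonempty by fastforce
  then have "card (verts G - {s}) \<le> card (head G ` arcs G)" by (intro card_mono) auto
  also have "\<dots> \<le> card (arcs G)" by (rule card_image_le) simp
  finally show ?thesis using source(1) by simp
qed

text \<open>Conservation is summed over \<open>R\<close>, with the inflow added to both sides rather
  than subtracted. Each arc with tail in \<open>R\<close> has its head in \<open>R\<close> or leaves
  \<open>R\<close>; arcs entering from outside make it an inequality.\<close>

lemma val_le_cut:
  assumes g: "is_flow G s t g" and R: "R \<subseteq> verts G" "s \<in> R" "t \<notin> R"
  shows "val g \<le> (\<Sum>e\<in>leaving R. g e)"
proof -
  have fR: "finite R" using R finite_subset[OF _ finite_verts] by blast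
  have outs: "(\<Sum>v\<in>R. \<Sum>e\<in>out_arcs G v. g e) = (\<Sum>e | e \<in> arcs G \<and> tail G e \<in> R. g e)"
  proof -
    have "(\<Sum>v\<in>R. \<Sum>e\<in>out_arcs G v. g e) = sum g (\<Union>v\<in>R. out_arcs G v)"
      by (intro sum.UNION_disjoint[symmetric]) (auto simp: fR finite_out_arcs)
    also have "(\<Union>v\<in>R. out_arcs G v) = {e \<in> arcs G. tail G e \<in> R}" by auto
    finally show ?thesis .
  qed
  have ins: "(\<Sum>v\<in>R. \<Sum>e\<in>in_arcs G v. g e) = (\<Sum>e | e \<in> arcs G \<and> head G e \<in> R. g e)"
  proof -
    have "(\<Sum>v\<in>R. \<Sum>e\<in>in_arcs G v. g e) = sum g (\<Union>v\<in>R. in_arcs G v)"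
      by (intro sum.UNION_disjoint[symmetric]) (auto simp: fR finite_in_arcs)
    also have "(\<Union>v\<in>R. in_arcs G v) = {e \<in> arcs G. head G e \<in> R}" by auto
    finally show ?thesis .
  qed
  have "val g + (\<Sum>v\<in>R. \<Sum>e\<in>in_arcs G v. g e)
      = val g + (\<Sum>v\<in>R - {s}. \<Sum>e\<in>in_arcs G v. g e)"
    using source(2) by (simp add: sum.remove[OF fR R(2)])
  also have "(\<Sum>v\<in>R - {s}. \<Sum>e\<in>in_arcs G v. g e) = (\<Sum>v\<in>R - {s}. \<Sum>e\<in>out_arcs G v. g e)"
    by (intro sum.cong refl bspec[OF g[unfolded is_flow_def]]) (use R in auto)
  also have "val g + \<dots> = (\<Sum>v\<in>R. \<Sum>e\<in>out_arcs G v. g e)"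
    by (simp add: sum.remove[OF fR R(2)] val_def)
  also have "\<dots> = (\<Sum>e | e \<in> arcs G \<and> tail G e \<in> R. g e)" by (rule outs)
  also have "\<dots> \<le> (\<Sum>e \<in> {e \<in> arcs G. head G e \<in> R} \<union> leaving R. g e)"
    by (intro sum_mono2) (auto simp: leaving_def)
  also have "\<dots> = (\<Sum>e | e \<in> arcs G \<and> head G e \<in> R. g e) + (\<Sum>e\<in>leaving R. g e)"
    by (intro sum.union_disjoint) (auto simp: leaving_def)
  finally show ?thesis by (simp add: ins)
qed

text \<open>Well-founded induction along the arcs: if nothing leaves the source, then nothing
  enters, and so nothing leaves, any later vertex.\<close>

lemma flow_zero_if_val_zero:
  assumes g: "is_flow G s t g" and "val g = 0" and e: "e \<in> arcs G"
  shows "g e = 0"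
proof -
  have wf: "wf (arcs_ends G)"
    using acyclic_ends by (intro finite_acyclic_wf) (simp_all add: arcs_ends_def)
  have "\<forall>e \<in> out_arcs G v. g e = 0" for v
    using wf
  proof (induction v rule: wf_induct_rule)
    case (less v)
    show ?case
    proof (cases "v \<in> verts G - {s, t}")
      case True
      have "g e = 0" if "e \<in> in_arcs G v" for e
        using that less[of "tail G e"] by (auto simp: arcs_ends_conv)
      then have "(\<Sum>e\<in>out_arcs G v. g e) = 0"
        using bspec[OF g[unfolded is_flow_def] True] by (metis (no_types, lifting) sum.neutral)
      then show ?thesis by (simp add: finite_out_arcs)
    next
      case False
      then consider "v = s" | "v = t" | "v \<notin> verts G" by blast
      then show ?thesis
        using \<open>val g = 0\<close> sink(2) by cases (auto simp: val_def finite_out_arcs)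
    qed
  qed
  then show ?thesis using e by auto
qed

text \<open>Makes the splitting into unit paths complete: a flow minus paths is again a flow, so
  once blocked it is zero.\<close>

lemma blocked_flow_zero:
  assumes g: "is_flow G s t g" and "blocked g" and e: "e \<in> arcs G"
  shows "g e = 0"
proof -
  obtain R where R: "R \<subseteq> verts G" "s \<in> R" "t \<notin> R" "\<forall>e \<in> leaving R. g e = 0"
    using \<open>blocked g\<close> by (auto simp: blocked_def)
  have "val g \<le> 0" using val_le_cut[OF g R(1-3)] R(4) by simp
  then show ?thesis using flow_zero_if_val_zero[OF g _ e] by simp
qed

section \<open>Minimal cut-sets and the parallel-width\<close>

lemma finite_minimal_cuts: "finite {X. minimal_cut_set G s t X}"
  by (rule finite_subset[of _ "Pow (arcs G)"]) (auto simp: minimal_cut_set_def cut_set_def)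

lemma cut_set_leaving:
  assumes "s \<in> R" "t \<notin> R"
  shows "cut_set G s t (leaving R)"
  unfolding cut_set_def
proof
  let ?H = "G\<lparr>arcs := arcs G - leaving R\<rparr>"
  have stays: "v \<in> R" if u: "u \<in> R" and uv: "(u, v) \<in> arcs_ends ?H" for u v
  proof -
    obtain e where "e \<in> arcs G - leaving R" "u = tail G e" "v = head G e"
      using uv by (force simp: arcs_ends_conv)
    then show ?thesis using u by (simp add: leaving_def)
  qed
  show "leaving R \<subseteq> arcs G" by (simp add: leaving_def)
  show "\<not> reachable ?H s t"
  proof
    assume "reachable ?H s t"
    then have "(s, t) \<in> (arcs_ends ?H)\<^sup>*" by (rule reachable_rtranclI)
    then have "t \<in> R"
    proof (induction rule: rtrancl_induct)
      case base
      show ?case by (rule assms(1))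
    next
      case (step y z)
      then show ?case using stays by blast
    qed
    then show False using assms(2) by simp
  qed
qed

text \<open>\<open>R\<close> consists of the vertices still reachable from \<open>s\<close> once
  \<open>X\<close> is removed. An arbitrary cut-set thus gives a vertex set to which
  \<open>val_le_cut\<close> applies.\<close>

lemma cut_set_leaving_subset:
  assumes "cut_set G s t X"
  shows "\<exists>R \<subseteq> verts G. s \<in> R \<and> t \<notin> R \<and> leaving R \<subseteq> X"
proof -
  let ?r = "rtrancl_on (verts G) (arcs_ends (G\<lparr>arcs := arcs G - X\<rparr>))"
  let ?R = "{v. (s, v) \<in> ?r}"
  have "?R \<subseteq> verts G" using in_rtrancl_on_in_F(2)[of s _ "verts G"] by (intro subsetI) simp
  moreover have "s \<in> ?R" using source(1) by simp
  moreover have "t \<notin> ?R" using assms by (auto simp: cut_set_def reachable_def)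
  moreover have "leaving ?R \<subseteq> X"
  proof
    fix e assume e: "e \<in> leaving ?R"
    show "e \<in> X"
    proof (rule ccontr)
      assume "e \<notin> X"
      then have "(tail G e, head G e) \<in> arcs_ends (G\<lparr>arcs := arcs G - X\<rparr>)"
        using e by (auto simp: arcs_ends_conv leaving_def)
      then have "(s, head G e) \<in> ?r"
        by (rule rtrancl_on_into_rtrancl_on[rotated]) (use e in \<open>simp_all add: leaving_def\<close>)
      then show False using e by (simp add: leaving_def)
    qed
  qed
  ultimately show ?thesis by blast
qed

lemma ex_minimal_cut_subset:
  assumes "cut_set G s t X"
  shows "\<exists>Y \<subseteq> X. minimal_cut_set G s t Y"
proof -
  have "finite X" using assms finite_subset[OF _ finite_arcs] by (auto simp: cut_set_def)
  then show ?thesis using assms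
  proof (induction X rule: finite_psubset_induct)
    case (psubset X)
    show ?case
    proof (cases "minimal_cut_set G s t X")
      case False
      then obtain Y where "Y \<subset> X" "cut_set G s t Y"
        using psubset.prems by (auto simp: minimal_cut_set_def)
      then show ?thesis using psubset.IH[of Y] by blast
    qed blast
  qed
qed

lemma card_le_parallel_width:
  "minimal_cut_set G s t X \<Longrightarrow> card X \<le> parallel_width G s t"
  unfolding parallel_width_def using finite_minimal_cuts by (intro Max_ge) auto

text \<open>The maximum ranges over a nonempty family, as the cut-set \<open>leaving {s}\<close>
  contains a minimal one, so it is the size of some set of arcs.\<close>

lemma parallel_width_le: "parallel_width G s t \<le> card (arcs G)"
proof -
  have "s \<in> {s}" "t \<notin> {s}" using source_neq_sink by auto
  then obtain Y where "minimal_cut_set G s t Y"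
    using ex_minimal_cut_subset[OF cut_set_leaving] by blast
  then have "parallel_width G s t \<in> card ` {X. minimal_cut_set G s t X}"
    unfolding parallel_width_def using finite_minimal_cuts by (intro Max_in) auto
  then show ?thesis
    by (auto simp: minimal_cut_set_def cut_set_def intro!: card_mono)
qed

text \<open>
  The arcs leaving the blocking set carry at most one unit. They form a cut-set, and a
  minimal cut-set inside it is again crossed by the whole flow.
\<close>

lemma val_le_parallel_width:
  assumes g: "is_flow G s t g" and c: "blocked c"
    and le: "\<And>e. e \<in> arcs G \<Longrightarrow> c e = 0 \<Longrightarrow> g e \<le> 1"
  shows "val g \<le> parallel_width G s t"
proof -
  obtain R where R: "s \<in> R" "t \<notin> R" "\<forall>e \<in> leaving R. c e = 0"
    using c by (auto simp: blocked_def)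
  obtain X where X: "X \<subseteq> leaving R" "minimal_cut_set G s t X"
    using ex_minimal_cut_subset[OF cut_set_leaving[OF R(1,2)]] by blast
  then have "cut_set G s t X" by (simp add: minimal_cut_set_def)
  then obtain S where S: "S \<subseteq> verts G" "s \<in> S" "t \<notin> S" "leaving S \<subseteq> X"
    using cut_set_leaving_subset by blast
  have fin: "finite X" using X(1) by (rule finite_subset) (simp add: leaving_def)
  have "val g \<le> (\<Sum>e\<in>leaving S. g e)" by (rule val_le_cut[OF g S(1-3)])
  also have "\<dots> \<le> (\<Sum>e\<in>leaving S. 1)"
  proof (intro sum_mono le)
    fix e assume "e \<in> leaving S"
    then show "e \<in> arcs G" "c e = 0"
      using S(4) X(1) R(3) by (auto simp: leaving_def)
  qed
  also have "\<dots> \<le> card X" using S(4) fin by (simp add: card_mono)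
  also have "\<dots> \<le> parallel_width G s t" by (rule card_le_parallel_width[OF X(2)])
  finally show ?thesis .
qed

section \<open>Weighted sums of paths\<close>

definition path_sum :: "('b list \<times> nat) list \<Rightarrow> 'b \<Rightarrow> nat" where
  "path_sum D e = (\<Sum>(p, w) \<leftarrow> D. w * of_bool (e \<in> set p))"

lemma path_sum_simps [simp]:
  "path_sum [] e = 0"
  "path_sum ((p, w) # D) e = w * of_bool (e \<in> set p) + path_sum D e"
  "path_sum (D @ D') e = path_sum D e + path_sum D' e"
  by (simp_all add: path_sum_def)

text \<open>The two extra indicators balance the ends of the path without subtraction, and an
  arbitrary start \<open>u\<close> lets the induction remove the first arc.\<close>

lemma sum_of_bool_path:
  assumes "apath u p v"
  shows "(\<Sum>e\<in>in_arcs G x. of_bool (e \<in> set p)) + of_bool (x = u)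
       = (\<Sum>e\<in>out_arcs G x. of_bool (e \<in> set p)) + (of_bool (x = v) :: nat)"
  using assms
proof (induction p arbitrary: u)
  case Nil
  then show ?case by (auto simp: apath_Nil_iff)
next
  case (Cons e p)
  from Cons.prems have e: "e \<in> arcs G" "u = tail G e" and p: "apath (head G e) p v"
    by (auto simp: apath_Cons_iff)
  have "e \<notin> set p" using apath_distinct[OF Cons.prems] by simp
  \<comment> \<open>A path uses no arc twice, so its indicator is the sum of those of its first arc
    and of the rest.\<close>
  then have split: "of_bool (e' \<in> set (e # p)) = of_bool (e' = e) + (of_bool (e' \<in> set p) :: nat)" for e'
    by auto
  have "(\<Sum>e'\<in>in_arcs G x. of_bool (e' = e)) = (of_bool (x = head G e) :: nat)"
    "(\<Sum>e'\<in>out_arcs G x. of_bool (e' = e)) = (of_bool (x = tail G e) :: nat)"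
    using e(1) by (auto simp: of_bool_def finite_in_arcs finite_out_arcs)
  then show ?case
    using Cons.IH[OF p] by (simp add: split sum.distrib e(2) del: set_simps)
qed

lemma path_sum_conserved:
  assumes "\<forall>(p, w) \<in> set D. apath s p t" "v \<noteq> s" "v \<noteq> t"
  shows "(\<Sum>e\<in>in_arcs G v. path_sum D e) = (\<Sum>e\<in>out_arcs G v. path_sum D e)"
  using assms
proof (induction D)
  case (Cons d D)
  obtain p w where d: "d = (p, w)" by fastforce
  then have "apath s p t" using Cons.prems by auto
  then have "(\<Sum>e\<in>in_arcs G v. of_bool (e \<in> set p)) = (\<Sum>e\<in>out_arcs G v. (of_bool (e \<in> set p) :: nat))"
    using sum_of_bool_path[of s p t v] Cons.prems by simp
  then show ?case
    using Cons by (simp add: d sum.distrib sum_distrib_left[symmetric])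
qed simp

text \<open>Needed with \<open>c = 2\<close> for the remainder \<open>f - 2 g\<close> and with
  \<open>c = 1\<close> for the residual of the unit search.\<close>

lemma is_flow_add_path_sum:
  assumes D: "\<forall>(p, w) \<in> set D. apath s p t"
    and eq: "\<And>e. e \<in> arcs G \<Longrightarrow> f e = g e + c * path_sum D e"
    and f: "is_flow G s t f"
  shows "is_flow G s t g"
  unfolding is_flow_def
proof
  fix v assume v: "v \<in> verts G - {s, t}"
  have "(\<Sum>e\<in>in_arcs G v. g e) + c * (\<Sum>e\<in>in_arcs G v. path_sum D e) = (\<Sum>e\<in>in_arcs G v. f e)"
    by (simp add: eq sum.distrib sum_distrib_left)
  also have "\<dots> = (\<Sum>e\<in>out_arcs G v. f e)" using f v by (simp add: is_flow_def)
  also have "\<dots> = (\<Sum>e\<in>out_arcs G v. g e) + c * (\<Sum>e\<in>out_arcs G v. path_sum D e)"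
    by (simp add: eq sum.distrib sum_distrib_left)
  finally show "(\<Sum>e\<in>in_arcs G v. g e) = (\<Sum>e\<in>out_arcs G v. g e)"
    using path_sum_conserved[OF D] v by simp
qed

lemma flow_decomposition_iff:
  "flow_decomposition G s t f D \<longleftrightarrow>
     (\<forall>(p, w) \<in> set D. apath s p t) \<and> (\<forall>e \<in> arcs G. f e = path_sum D e)"
  by (simp add: flow_decomposition_def path_sum_def)

text \<open>\<open>D\<close> guarantees that the least numbers in \<open>width\<close> and
  \<open>mfd\<close> are attained, so that an optimal decomposition can serve as a cover. The width
  is positive because there is an arc to cover.\<close>

lemma width_pos_le_mfd:
  assumes D: "flow_decomposition G s t f D" and pos: "\<forall>e \<in> arcs G. f e > 0"
  shows "0 < width G s t" "width G s t \<le> mfd G s t f"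
proof -
  define covers where "covers k \<longleftrightarrow> (\<exists>ps. (\<forall>p \<in> set ps. apath s p t) \<and>
      arcs G \<subseteq> (\<Union>p \<in> set ps. set p) \<and> length ps = k)" for k
  have width: "width G s t = (LEAST k. covers k)" by (simp add: width_def covers_def)
  have cov: "covers (length D')" if D': "flow_decomposition G s t f D'" for D'
  proof -
    have "e \<in> (\<Union>p \<in> set (map fst D'). set p)" if e: "e \<in> arcs G" for e
    proof (rule ccontr)
      assume "e \<notin> (\<Union>p \<in> set (map fst D'). set p)"
      then have "path_sum D' e = 0" by (force simp: path_sum_def)
      then show False using D' pos e by (auto simp: flow_decomposition_iff)
    qed
    moreover have "\<forall>p \<in> set (map fst D'). apath s p t"
      using D' by (auto simp: flow_decomposition_iff)
    ultimately show ?thesis unfolding covers_def by (intro exI[of _ "map fst D'"]) auto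
  qed
  have "covers (width G s t)" unfolding width using cov[OF D] by (rule LeastI[of covers])
  then show "0 < width G s t" using arcs_nonempty by (auto simp: covers_def)
  obtain D' where "flow_decomposition G s t f D'" "length D' = mfd G s t f"
    using LeastI[of "\<lambda>k. \<exists>D. flow_decomposition G s t f D \<and> length D = k" "length D"] D
    unfolding mfd_def by blast
  then show "width G s t \<le> mfd G s t f"
    unfolding width using cov Least_le[of covers] by metis
qed

end

section \<open>Running time of programs\<close>

text \<open>Total correctness with a postcondition that also sees the time. Existence of a run
  suffices since execution is deterministic. The equivalences below form a weakest-precondition
  calculus for the simplifier.\<close>

definition runs :: "nat \<Rightarrow> com \<Rightarrow> state \<Rightarrow> (nat \<Rightarrow> state \<Rightarrow> bool) \<Rightarrow> bool" where
  "runs B c \<sigma> Q \<longleftrightarrow> (\<exists>T \<tau>. exec B c \<sigma> T \<tau> \<and> Q T \<tau>)"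

lemma runsI: "exec B c \<sigma> T \<tau> \<Longrightarrow> Q T \<tau> \<Longrightarrow> runs B c \<sigma> Q"
  by (auto simp: runs_def)

lemma runsE:
  assumes "runs B c \<sigma> Q"
  obtains T \<tau> where "exec B c \<sigma> T \<tau>" "Q T \<tau>"
  using assms by (auto simp: runs_def)

lemma runs_Skip [simp]: "runs B Skip \<sigma> Q \<longleftrightarrow> Q 1 \<sigma>"
  by (rule iffI, erule runsE, erule exec_SkipE, simp, rule runsI[OF exec.Skip])

lemma runs_Assign [simp]:
  "runs B (Assign x a) \<sigma> Q \<longleftrightarrow>
     afits B a \<sigma> \<and> Q (1 + acost a) (\<sigma>\<lparr>reg := (reg \<sigma>)(x := aval a \<sigma>)\<rparr>)"
  by (rule iffI, erule runsE, erule exec_AssignE, simp, erule conjE, rule runsI[OF exec.Assign])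

lemma runs_Store [simp]:
  "runs B (Store x i a) \<sigma> Q \<longleftrightarrow>
     afits B i \<sigma> \<and> afits B a \<sigma> \<and>
     Q (1 + acost i + acost a) (\<sigma>\<lparr>arr := (arr \<sigma>)(x := (arr \<sigma> x)(aval i \<sigma> := aval a \<sigma>))\<rparr>)"
  by (rule iffI, erule runsE, erule exec_StoreE, simp, elim conjE, rule runsI[OF exec.Store])

lemma runs_Seq [simp]:
  "runs B (Seq c d) \<sigma> Q \<longleftrightarrow> runs B c \<sigma> (\<lambda>T \<rho>. runs B d \<rho> (\<lambda>T' \<tau>. Q (1 + T + T') \<tau>))"
proof
  assume "runs B (Seq c d) \<sigma> Q"
  then obtain T \<tau> where e: "exec B (Seq c d) \<sigma> T \<tau>" and Q: "Q T \<tau>" by (rule runsE)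
  from e show "runs B c \<sigma> (\<lambda>T \<rho>. runs B d \<rho> (\<lambda>T' \<tau>. Q (1 + T + T') \<tau>))"
    by (rule exec_SeqE) (use Q in \<open>auto intro!: runsI\<close>)
next
  assume "runs B c \<sigma> (\<lambda>T \<rho>. runs B d \<rho> (\<lambda>T' \<tau>. Q (1 + T + T') \<tau>))"
  then show "runs B (Seq c d) \<sigma> Q"
    by (elim runsE) (rule runsI[OF exec.Seq])
qed

lemma runs_Cond [simp]:
  "runs B (Cond b c d) \<sigma> Q \<longleftrightarrow>
     bfits B b \<sigma> \<and> (bval b \<sigma> \<longrightarrow> runs B c \<sigma> (\<lambda>T. Q (1 + bcost b + T))) \<and>
     (\<not> bval b \<sigma> \<longrightarrow> runs B d \<sigma> (\<lambda>T. Q (1 + bcost b + T)))"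
proof
  assume "runs B (Cond b c d) \<sigma> Q"
  then obtain T \<tau> where e: "exec B (Cond b c d) \<sigma> T \<tau>" and Q: "Q T \<tau>" by (rule runsE)
  from e show "bfits B b \<sigma> \<and> (bval b \<sigma> \<longrightarrow> runs B c \<sigma> (\<lambda>T. Q (1 + bcost b + T))) \<and>
     (\<not> bval b \<sigma> \<longrightarrow> runs B d \<sigma> (\<lambda>T. Q (1 + bcost b + T)))"
    by (rule exec_CondE) (use Q in \<open>auto intro: runsI\<close>)
next
  assume a: "bfits B b \<sigma> \<and> (bval b \<sigma> \<longrightarrow> runs B c \<sigma> (\<lambda>T. Q (1 + bcost b + T))) \<and>
     (\<not> bval b \<sigma> \<longrightarrow> runs B d \<sigma> (\<lambda>T. Q (1 + bcost b + T)))"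
  show "runs B (Cond b c d) \<sigma> Q"
  proof (cases "bval b \<sigma>")
    case True
    with a have "runs B c \<sigma> (\<lambda>T. Q (1 + bcost b + T))" by simp
    then show ?thesis by (rule runsE) (rule runsI[OF exec.CondTrue], use a True in simp_all)
  next
    case False
    with a have "runs B d \<sigma> (\<lambda>T. Q (1 + bcost b + T))" by simp
    then show ?thesis by (rule runsE) (rule runsI[OF exec.CondFalse], use a False in simp_all)
  qed
qed

lemma runs_mono: "runs B c \<sigma> Q \<Longrightarrow> (\<And>T \<tau>. Q T \<tau> \<Longrightarrow> Q' T \<tau>) \<Longrightarrow> runs B c \<sigma> Q'"
  by (auto simp: runs_def)

section \<open>Parts of the state that a program leaves unchanged\<close>

primrec written_regs :: "com \<Rightarrow> string set" where
  "written_regs Skip = {}"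
| "written_regs (Assign x a) = {x}"
| "written_regs (Store x i a) = {}"
| "written_regs (Seq c d) = written_regs c \<union> written_regs d"
| "written_regs (Cond b c d) = written_regs c \<union> written_regs d"
| "written_regs (While b c) = written_regs c"

primrec written_arrs :: "com \<Rightarrow> string set" where
  "written_arrs Skip = {}"
| "written_arrs (Assign x a) = {}"
| "written_arrs (Store x i a) = {x}"
| "written_arrs (Seq c d) = written_arrs c \<union> written_arrs d"
| "written_arrs (Cond b c d) = written_arrs c \<union> written_arrs d"
| "written_arrs (While b c) = written_arrs c"

definition framed :: "com \<Rightarrow> state \<Rightarrow> state \<Rightarrow> bool" where
  "framed c \<sigma> \<tau> \<longleftrightarrow>
     (\<forall>x. x \<notin> written_regs c \<longrightarrow> reg \<tau> x = reg \<sigma> x) \<and>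
     (\<forall>a. a \<notin> written_arrs c \<longrightarrow> arr \<tau> a = arr \<sigma> a)"

lemma framed_refl: "framed c \<sigma> \<sigma>"
  by (simp add: framed_def)

lemma framed_trans: "framed c \<sigma> \<rho> \<Longrightarrow> framed c \<rho> \<tau> \<Longrightarrow> framed c \<sigma> \<tau>"
  by (simp add: framed_def)

lemma framed_reg: "framed c \<sigma> \<tau> \<Longrightarrow> x \<notin> written_regs c \<Longrightarrow> reg \<tau> x = reg \<sigma> x"
  and framed_arr: "framed c \<sigma> \<tau> \<Longrightarrow> a \<notin> written_arrs c \<Longrightarrow> arr \<tau> a = arr \<sigma> a"
  by (simp_all add: framed_def)

lemma exec_framed: "exec B c \<sigma> T \<tau> \<Longrightarrow> framed c \<sigma> \<tau>"
  by (induction rule: exec.induct) (auto simp: framed_def)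

lemma runs_framed: "runs B c \<sigma> Q \<Longrightarrow> runs B c \<sigma> (\<lambda>T \<tau>. Q T \<tau> \<and> framed c \<sigma> \<tau>)"
  by (erule runsE) (rule runsI, assumption, simp add: exec_framed)

text \<open>\<open>V\<close> is a credit: each iteration pays for its guard and body out of the drop
  of \<open>V\<close>, which yields termination and running time at once. The frame condition is
  supplied by the rule, so \<open>I\<close> need not mention unchanged variables. The surplus in
  \<open>exit\<close> is the last, failing guard.\<close>

lemma runs_While:
  assumes init: "I \<sigma>"
    and fits: "\<And>\<rho>. I \<rho> \<Longrightarrow> framed c \<sigma> \<rho> \<Longrightarrow> bfits B b \<rho>"
    and body: "\<And>\<rho>. I \<rho> \<Longrightarrow> framed c \<sigma> \<rho> \<Longrightarrow> bval b \<rho> \<Longrightarrow>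
      runs B c \<rho> (\<lambda>T \<tau>. I \<tau> \<and> V \<tau> + T + 1 + bcost b \<le> V \<rho>)"
    and exit: "\<And>T \<tau>. I \<tau> \<Longrightarrow> framed c \<sigma> \<tau> \<Longrightarrow> \<not> bval b \<tau> \<Longrightarrow>
      T + V \<tau> \<le> V \<sigma> + 1 + bcost b \<Longrightarrow> Q T \<tau>"
  shows "runs B (While b c) \<sigma> Q"
proof -
  have "\<exists>T \<tau>. exec B (While b c) \<rho> T \<tau> \<and> I \<tau> \<and> framed c \<rho> \<tau> \<and> \<not> bval b \<tau> \<and>
      T + V \<tau> \<le> V \<rho> + 1 + bcost b"
    if "I \<rho>" "framed c \<sigma> \<rho>" for \<rho>
    using that
  proof (induction "V \<rho>" arbitrary: \<rho> rule: less_induct)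
    case less
    have fit: "bfits B b \<rho>" by (rule fits[OF less.prems])
    show ?case
    proof (cases "bval b \<rho>")
      case True
      obtain T \<rho>' where step: "exec B c \<rho> T \<rho>'" "I \<rho>'" "V \<rho>' + T + 1 + bcost b \<le> V \<rho>"
        using body[OF less.prems True] by (auto simp: runs_def)
      have fr: "framed c \<rho> \<rho>'" by (rule exec_framed[OF step(1)])
      obtain T' \<tau> where rest: "exec B (While b c) \<rho>' T' \<tau>" "I \<tau>" "framed c \<rho>' \<tau>" "\<not> bval b \<tau>"
          "T' + V \<tau> \<le> V \<rho>' + 1 + bcost b"
        using less.hyps[of \<rho>'] step framed_trans[OF less.prems(2) fr] by auto
      have "exec B (While b c) \<rho> (1 + bcost b + T + T') \<tau>"
        by (rule exec.WhileTrue[OF fit True step(1) rest(1)])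
      then show ?thesis
        using rest step(3) framed_trans[OF fr rest(3)]
        by (intro exI[of _ "1 + bcost b + T + T'"] exI[of _ \<tau>]) simp
    next
      case False
      then show ?thesis
        using exec.WhileFalse[OF fit False] less.prems framed_refl
        by (intro exI[of _ "1 + bcost b"] exI[of _ \<rho>]) simp
    qed
  qed
  from this[OF init framed_refl] show ?thesis
    using exit by (auto simp: runs_def)
qed

abbreviation seq_com :: "com \<Rightarrow> com \<Rightarrow> com" (infixr \<open>;;\<close> 60) where
  "c ;; d \<equiv> Seq c d"

abbreviation incr :: "string \<Rightarrow> com" where
  "incr x \<equiv> Assign x (Plus (Reg x) (Const 1))"

section \<open>Blocking flows\<close>

definition subtract_along :: com where
  "subtract_along =
     Assign ''j'' (Reg ''pos'') ;;
     While (Less (Reg ''j'') (Reg ''q''))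
       (Store ''cap'' (Cell ''path'' (Reg ''j''))
          (Minus (Cell ''cap'' (Cell ''path'' (Reg ''j''))) (Reg ''bot'')) ;;
        incr ''j'')"

text \<open>\<open>start[k]\<close> already holds \<open>pos\<close>, left there by the previous
  path or zero at the beginning, so only the end of the new list is written.\<close>

definition record_path :: com where
  "record_path =
     Store ''weight'' (Reg ''k'') (Reg ''u'') ;;
     incr ''k'' ;;
     Store ''start'' (Reg ''k'') (Reg ''q'') ;;
     Assign ''pos'' (Reg ''q'')"

text \<open>\<open>lim\<close> is the bottleneck of the empty walk, and \<open>pos\<close> is the
  first free cell of \<open>path\<close>, so an unfinished walk gets overwritten.\<close>

definition restart :: com where
  "restart =
     Assign ''v'' (Reg ''s'') ;; Assign ''q'' (Reg ''pos'') ;; Assign ''bot'' (Reg ''lim'')"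

definition augment :: com where
  "augment = subtract_along ;; record_path ;; restart"

definition push_step :: com where
  "push_step =
     Store ''path'' (Reg ''q'') (Reg ''e'') ;;
     incr ''q'' ;;
     Assign ''v'' (Cell ''head'' (Reg ''e'')) ;;
     Cond (Less (Cell ''cap'' (Reg ''e'')) (Reg ''bot''))
       (Assign ''bot'' (Cell ''cap'' (Reg ''e''))) Skip ;;
     Cond (Equal (Reg ''v'') (Reg ''t'')) augment Skip"

definition advance_step :: com where
  "advance_step =
     Store ''ptr'' (Reg ''v'') (Plus (Reg ''e'') (Const 1)) ;;
     Cond (Equal (Plus (Reg ''e'') (Const 1)) (Reg ''m'')) restart Skip"

text \<open>
  The pointer of \<open>v\<close> scans all arcs, including those that do not leave \<open>v\<close>. It reaches \<open>m\<close> when no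
  further path from \<open>v\<close> to the sink exists. The pointer of the sink itself stays \<open>0\<close>, so that the
  last condition always admits arcs into the sink.
\<close>

definition walk_step :: com where
  "walk_step =
     Assign ''e'' (Cell ''ptr'' (Reg ''v'')) ;;
     Cond (Conj (Equal (Cell ''tail'' (Reg ''e'')) (Reg ''v''))
            (Conj (Less (Const 0) (Cell ''cap'' (Reg ''e'')))
              (Less (Cell ''ptr'' (Cell ''head'' (Reg ''e''))) (Reg ''m''))))
       push_step advance_step"

definition blocking :: com where
  "blocking =
     Assign ''v'' (Const 0) ;;
     While (Less (Reg ''v'') (Reg ''n'')) (Store ''ptr'' (Reg ''v'') (Const 0) ;; incr ''v'') ;;
     restart ;;
     While (Less (Cell ''ptr'' (Reg ''s'')) (Reg ''m'')) walk_step"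

text \<open>The loop rereads \<open>cap\<close> at every position; distinctness ensures that each
  arc is lowered only once. The final state is given completely up to the loop counter, so that
  symbolic execution can continue from it.\<close>

lemma subtract_along_runs:
  assumes "reg \<sigma> ''pos'' \<le> reg \<sigma> ''q''" "reg \<sigma> ''q'' < B" "reg \<sigma> ''bot'' < B" "1 < B"
    and dist: "distinct (map (arr \<sigma> ''path'') [reg \<sigma> ''pos''..<reg \<sigma> ''q''])"
    and bd: "\<And>i. reg \<sigma> ''pos'' \<le> i \<Longrightarrow> i < reg \<sigma> ''q'' \<Longrightarrow>
      arr \<sigma> ''path'' i < B \<and> arr \<sigma> ''cap'' (arr \<sigma> ''path'' i) < B"
  shows "runs B subtract_along \<sigma> (\<lambda>T \<tau>.
    (\<exists>j. \<tau> = \<sigma>\<lparr>reg := (reg \<sigma>)(''j'' := j),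
         arr := (arr \<sigma>)(''cap'' := (\<lambda>e.
            if e \<in> set (map (arr \<sigma> ''path'') [reg \<sigma> ''pos''..<reg \<sigma> ''q''])
            then arr \<sigma> ''cap'' e - reg \<sigma> ''bot'' else arr \<sigma> ''cap'' e))\<rparr>) \<and>
    T \<le> 20 * (reg \<sigma> ''q'' - reg \<sigma> ''pos'') + 10)"
proof -
  let ?p = "reg \<sigma> ''pos''" and ?q = "reg \<sigma> ''q''" and ?path = "arr \<sigma> ''path''"
    and ?cap = "arr \<sigma> ''cap''" and ?bot = "reg \<sigma> ''bot''"
  define sub where "sub j e = (if e \<in> set (map ?path [?p..<j]) then ?cap e - ?bot else ?cap e)" for j e
  have fresh: "?path i \<notin> set (map ?path [?p..<i])" if "?p \<le> i" "i < ?q" for i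
  proof
    assume "?path i \<in> set (map ?path [?p..<i])"
    then obtain j where "?p \<le> j" "j < i" "?path i = ?path j" by auto
    moreover have "inj_on ?path {?p..<?q}" using dist by (simp add: distinct_map)
    ultimately show False using that by (auto dest!: inj_onD)
  qed
  have sub_Suc: "(sub i)(?path i := ?cap (?path i) - ?bot) = sub (Suc i)"
    "sub i (?path i) = ?cap (?path i)" if "?p \<le> i" "i < ?q" for i
    using fresh[OF that] that by (auto simp: sub_def fun_eq_iff)
  define I where "I \<rho> \<longleftrightarrow> (\<exists>j. ?p \<le> j \<and> j \<le> ?q \<and>
      \<rho> = \<sigma>\<lparr>reg := (reg \<sigma>)(''j'' := j), arr := (arr \<sigma>)(''cap'' := sub j)\<rparr>)" for \<rho> :: state
  have sub0: "sub ?p = ?cap" by (simp add: sub_def fun_eq_iff)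
  show ?thesis
    unfolding subtract_along_def runs_Seq runs_Assign
  proof (intro conjI, goal_cases)
    case 1
    show ?case using assms(1,2) by simp
  next
    case 2
    show ?case
    proof (rule runs_While[where I = I and V = "\<lambda>\<rho>. 20 * (?q - reg \<rho> ''j'')"], goal_cases)
      case 1
      have "\<sigma>\<lparr>reg := (reg \<sigma>)(''j'' := ?p), arr := (arr \<sigma>)(''cap'' := sub ?p)\<rparr>
          = \<sigma>\<lparr>reg := (reg \<sigma>)(''j'' := ?p)\<rparr>"
        unfolding sub0 by (cases \<sigma>) simp
      then show ?case using assms(1) unfolding I_def by (intro exI[of _ ?p]) simp
    next
      case (2 \<rho>)
      then show ?case using assms by (auto simp: I_def)
    next
      case (3 \<rho>)
      then obtain j where j: "?p \<le> j" "j < ?q"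
        and \<rho>: "\<rho> = \<sigma>\<lparr>reg := (reg \<sigma>)(''j'' := j), arr := (arr \<sigma>)(''cap'' := sub j)\<rparr>"
        by (auto simp: I_def)
      show ?case
        using j assms bd[OF j] sub_Suc[OF j]
        by (auto simp: \<rho> I_def intro!: exI[of _ "Suc j"])
    next
      case (4 T \<tau>)
      then obtain j where j: "j = ?q"
        and \<tau>: "\<tau> = \<sigma>\<lparr>reg := (reg \<sigma>)(''j'' := j), arr := (arr \<sigma>)(''cap'' := sub j)\<rparr>"
        by (auto simp: I_def)
      have "sub ?q = (\<lambda>e. if e \<in> set (map ?path [?p..<?q]) then ?cap e - ?bot else ?cap e)"
        by (simp add: sub_def fun_eq_iff)
      then show ?case
        using 4(4) by (auto simp: \<tau> j)
    qed
  qed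
qed

definition output_list :: "(nat \<Rightarrow> nat) \<Rightarrow> (nat \<Rightarrow> nat) \<Rightarrow> (nat \<Rightarrow> nat) \<Rightarrow> nat \<Rightarrow> (nat list \<times> nat) list" where
  "output_list path start weight k =
     map (\<lambda>i. (map path [start i..<start (Suc i)], weight i)) [0..<k]"

lemma program_output_eq:
  "program_output \<sigma> = output_list (arr \<sigma> ''path'') (arr \<sigma> ''start'') (arr \<sigma> ''weight'') (reg \<sigma> ''k'')"
  by (simp add: program_output_def output_list_def)

text \<open>All recorded lists end at or before \<open>pos\<close>, so a write at
  \<open>q \<ge> pos\<close> cannot disturb them.\<close>

lemma output_list_path_upd:
  assumes "\<forall>i\<le>k. start i \<le> pos" "pos \<le> q"
  shows "output_list (path(q := e)) start weight k = output_list path start weight k"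
proof -
  have "\<not> q < start (Suc i)" if "i < k" for i
    using assms that by (meson Suc_leI le_trans not_less)
  then show ?thesis by (auto simp: output_list_def)
qed

lemma output_list_append:
  assumes "start k = pos"
  shows "output_list path (start(Suc k := q)) (weight(k := u)) (Suc k)
    = output_list path start weight k @ [(map path [pos..<q], u)]"
  using assms by (auto simp: output_list_def)

section \<open>Invariant and potential of the search\<close>

locale numbered_network = st_network G s t for G :: "(nat, nat) pre_digraph" and s t +
  assumes numbered: "numbered G"
begin

abbreviation n :: nat where "n \<equiv> card (verts G)"
abbreviation m :: nat where "m \<equiv> card (arcs G)"

lemma verts_eq: "verts G = {..<n}" and arcs_eq: "arcs G = {..<m}"
  using numbered by (simp_all add: numbered_def)

lemma arc_iff: "e \<in> arcs G \<longleftrightarrow> e < m"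
  and vert_iff: "v \<in> verts G \<longleftrightarrow> v < n"
  using arcs_eq verts_eq by auto

lemma tail_less: "e < m \<Longrightarrow> tail G e < n" and head_less: "e < m \<Longrightarrow> head G e < n"
  using tail_in_verts head_in_verts by (simp_all add: arc_iff vert_iff)

lemma s_less: "s < n" and t_less: "t < n"
  using source(1) sink(1) by (simp_all add: vert_iff)

text \<open>
  The values \<open>cap0\<close>, \<open>D0\<close>, \<open>k0\<close>, \<open>start0\<close> are those at the start of the search. The list \<open>D\<close> holds the paths
  found so far with the amounts sent along them, whereas the program records the weight \<open>u\<close> for all
  of them.
\<close>

definition binv ::
  "((nat \<Rightarrow> nat) \<Rightarrow> nat) \<Rightarrow> nat \<Rightarrow> nat \<Rightarrow> (nat \<Rightarrow> nat) \<Rightarrow> (nat list \<times> nat) list \<Rightarrow> nat \<Rightarrow> (nat \<Rightarrow> nat) \<Rightarrow>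
   (nat \<Rightarrow> nat) \<Rightarrow> (nat \<Rightarrow> nat) \<Rightarrow> (nat \<Rightarrow> nat) \<Rightarrow> (nat \<Rightarrow> nat) \<Rightarrow> (nat \<Rightarrow> nat) \<Rightarrow>
   nat \<Rightarrow> nat \<Rightarrow> nat \<Rightarrow> nat \<Rightarrow> nat \<Rightarrow> bool" where
  "binv M lmt u cap0 D0 k0 start0 ptr cap path start weight k pos v q btl \<longleftrightarrow>
     v < n \<and> v \<noteq> t \<and> (v = s \<or> ptr v < m) \<and> (\<forall>w<n. ptr w \<le> m) \<and> ptr t = 0 \<and>
     pos \<le> q \<and> awalk s (map path [pos..<q]) v \<and>
     (\<forall>e\<in>set (map path [pos..<q]). btl \<le> cap e) \<and> 1 \<le> btl \<and> btl \<le> lmt \<and>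
     (btl = lmt \<or> (\<exists>e\<in>set (map path [pos..<q]). cap e = btl)) \<and>
     (\<forall>e<m. e < ptr (tail G e) \<longrightarrow> cap e = 0 \<or> ptr (head G e) = m) \<and>
     (\<exists>D. (\<forall>(p, a)\<in>set D. apath s p t \<and> 1 \<le> a \<and> a \<le> lmt) \<and>
        (\<forall>e<m. cap0 e = cap e + path_sum D e) \<and>
        output_list path start weight k = D0 @ map (\<lambda>(p, a). (p, u)) D) \<and>
     k0 \<le> k \<and> k + M cap \<le> k0 + M cap0 \<and> (\<forall>i\<le>k0. start i = start0 i) \<and>
     start k = pos \<and> (\<forall>i\<le>k. start i \<le> pos) \<and> pos \<le> k * n"

lemma binvD:
  assumes "binv M lmt u cap0 D0 k0 start0 ptr cap path start weight k pos v q btl"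
  shows "v < n" "v \<noteq> t" "v = s \<or> ptr v < m" "\<forall>w<n. ptr w \<le> m" "ptr t = 0"
    "pos \<le> q" "awalk s (map path [pos..<q]) v" "\<forall>e\<in>set (map path [pos..<q]). btl \<le> cap e"
    "1 \<le> btl" "btl \<le> lmt" "btl = lmt \<or> (\<exists>e\<in>set (map path [pos..<q]). cap e = btl)"
    "\<forall>e<m. e < ptr (tail G e) \<longrightarrow> cap e = 0 \<or> ptr (head G e) = m"
    "\<exists>D. (\<forall>(p, a)\<in>set D. apath s p t \<and> 1 \<le> a \<and> a \<le> lmt) \<and>
        (\<forall>e<m. cap0 e = cap e + path_sum D e) \<and>
        output_list path start weight k = D0 @ map (\<lambda>(p, a). (p, u)) D"
    "k0 \<le> k" "k + M cap \<le> k0 + M cap0" "\<forall>i\<le>k0. start i = start0 i"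
    "start k = pos" "\<forall>i\<le>k. start i \<le> pos" "pos \<le> k * n"
  by (insert assms, unfold binv_def, (elim conjE, assumption)+)

text \<open>
  \<open>M\<close> bounds the number of augmentations still to come. It is the number of nonempty arcs if
  the amount sent is never limited by \<open>lmt\<close>, and the value of the flow if \<open>lmt = 1\<close>.
\<close>

definition drops :: "((nat \<Rightarrow> nat) \<Rightarrow> nat) \<Rightarrow> nat \<Rightarrow> (nat \<Rightarrow> nat) \<Rightarrow> bool" where
  "drops M lmt cap0 \<longleftrightarrow> (\<forall>cap p a. (\<forall>e<m. cap e \<le> cap0 e) \<longrightarrow> apath s p t \<longrightarrow> 1 \<le> a \<longrightarrow>
     (\<forall>e\<in>set p. a \<le> cap e) \<longrightarrow> (a = lmt \<or> (\<exists>e\<in>set p. cap e = a)) \<longrightarrow>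
     M (\<lambda>e. if e \<in> set p then cap e - a else cap e) < M cap)"

text \<open>
  The summand \<open>n\<close> is released when the pointer of \<open>w\<close> reaches \<open>m\<close> and pays for restarting the walk.
\<close>

definition scan_pot :: "(nat \<Rightarrow> nat) \<Rightarrow> nat" where
  "scan_pot ptr = (\<Sum>w<n. if ptr w < m then m - ptr w + n else 0)"

lemma awalk_length_less: "awalk u p v \<Longrightarrow> length p < n"
  using length_apath_less[OF awalk_imp_apath] .

lemma binv_length: "binv M lmt u cap0 D0 k0 start0 ptr cap path start weight k pos v q btl \<Longrightarrow> q - pos < n"
  using awalk_length_less[of s "map path [pos..<q]" v] by (simp add: binv_def)

lemma scan_pot_upd:
  assumes "v < n" "ptr v < m"
  shows "scan_pot (ptr(v := Suc (ptr v))) + 1 + (if Suc (ptr v) = m then n else 0) = scan_pot ptr"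
proof -
  have "scan_pot p = (if p v < m then m - p v + n else 0)
      + (\<Sum>w\<in>{..<n} - {v}. if p w < m then m - p w + n else 0)" for p
    unfolding scan_pot_def using assms(1) by (intro sum.remove) auto
  moreover have "(\<Sum>w\<in>{..<n} - {v}. if (ptr(v := Suc (ptr v))) w < m then m - (ptr(v := Suc (ptr v))) w + n else 0)
      = (\<Sum>w\<in>{..<n} - {v}. if ptr w < m then m - ptr w + n else 0)"
    by (intro sum.cong) auto
  ultimately show ?thesis using assms(2) by (auto simp: not_less)
qed

text \<open>The arc at the pointer is useless: it does not leave \<open>v\<close>, or it is empty,
  or its head is exhausted. Capacities never grow and pointers never retreat, so it may be passed
  for good. The first result continues the scan; the second drops the walk and serves when the
  pointer of \<open>v\<close> reaches \<open>m\<close>.\<close>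

lemma binv_advance:
  assumes I: "binv M lmt u cap0 D0 k0 start0 ptr cap path start weight k pos v q btl"
    and v: "ptr v < m"
    and no: "\<not> (tail G (ptr v) = v \<and> 0 < cap (ptr v) \<and> ptr (head G (ptr v)) < m)"
  shows "Suc (ptr v) < m \<Longrightarrow>
      binv M lmt u cap0 D0 k0 start0 (ptr(v := Suc (ptr v))) cap path start weight k pos v q btl"
    and "binv M lmt u cap0 D0 k0 start0 (ptr(v := Suc (ptr v))) cap path start weight k pos s pos lmt"
proof -
  let ?ptr = "ptr(v := Suc (ptr v))"
  have le: "\<forall>w<n. ptr w \<le> m" and passed: "\<forall>e<m. e < ptr (tail G e) \<longrightarrow> cap e = 0 \<or> ptr (head G e) = m"
    and vt: "v \<noteq> t" and vn: "v < n" and lmt: "1 \<le> lmt" "s < n"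
    using binvD(4,12,2,1,9,10)[OF I] s_less by simp_all
  have le': "\<forall>w<n. ?ptr w \<le> m" using le v by auto
  have passed': "\<forall>e<m. e < ?ptr (tail G e) \<longrightarrow> cap e = 0 \<or> ?ptr (head G e) = m"
  proof (intro allI impI)
    fix e assume e: "e < m" "e < ?ptr (tail G e)"
    have "cap e = 0 \<or> ptr (head G e) = m"
    proof (cases "e < ptr (tail G e)")
      case True
      then show ?thesis using passed e(1) by blast
    next
      case False
      then have "tail G e = v" "e = ptr v" using e(2) by (auto split: if_splits)
      then have "cap e = 0 \<or> \<not> ptr (head G e) < m" using no by auto
      then show ?thesis using le head_less[OF e(1)] by (metis le_neq_implies_less)
    qed
    \<comment> \<open>A head whose pointer is \<open>m\<close> differs from \<open>v\<close>, so the
      update does not affect it.\<close>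
    then show "cap e = 0 \<or> ?ptr (head G e) = m" using v by auto
  qed
  show "binv M lmt u cap0 D0 k0 start0 ?ptr cap path start weight k pos v q btl" if "Suc (ptr v) < m"
    unfolding binv_def using binvD[OF I] that le' passed' by simp
  show "binv M lmt u cap0 D0 k0 start0 ?ptr cap path start weight k pos s pos lmt"
    unfolding binv_def using binvD(5,13-19)[OF I] le' passed' vt source_neq_sink lmt source(1)
    by (simp add: awalk_Nil_iff)
qed

text \<open>The new bottleneck is again attained, either by the new arc or by whatever attained the
  old one.\<close>

lemma binv_push:
  assumes I: "binv M lmt u cap0 D0 k0 start0 ptr cap path start weight k pos v q btl"
    and e: "e < m" "tail G e = v" "0 < cap e" "ptr (head G e) < m" "head G e \<noteq> t"
  shows "binv M lmt u cap0 D0 k0 start0 ptr cap (path(q := e)) start weight k pos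
    (head G e) (Suc q) (min btl (cap e))"
proof -
  have pq: "pos \<le> q" by (rule binvD(6)[OF I])
  then have path: "map (path(q := e)) [pos..<Suc q] = map path [pos..<q] @ [e]" by simp
  have out: "output_list (path(q := e)) start weight k = output_list path start weight k"
    by (rule output_list_path_upd[where start = start and k = k, OF binvD(18)[OF I] binvD(6)[OF I]])
  have walk: "awalk s (map path [pos..<q] @ [e]) (head G e)"
    using binvD(7)[OF I] e by (auto simp: awalk_Cons_iff awalk_Nil_iff arc_iff)
  have le: "\<forall>x\<in>set (map path [pos..<q] @ [e]). min btl (cap e) \<le> cap x"
    using binvD(8)[OF I] by (auto simp: min_le_iff_disj)
  have attained: "min btl (cap e) = lmt \<or> (\<exists>x\<in>set (map path [pos..<q] @ [e]). cap x = min btl (cap e))"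
  proof (cases "cap e < btl")
    case False
    then have "min btl (cap e) = btl" by simp
    then show ?thesis using binvD(11)[OF I] by (simp only: set_append) blast
  qed simp
  have bounds: "1 \<le> min btl (cap e)" "min btl (cap e) \<le> lmt"
    using binvD(9,10)[OF I] e(3) by simp_all
  show ?thesis
    unfolding binv_def path out
    by (intro conjI disjI2 head_less e(1,4,5) walk le attained bounds binvD(4,5,12-19)[OF I])
      (rule le_SucI, rule pq)
qed

text \<open>By acyclicity the completed walk is a path, and \<open>btl'\<close> exceeds none of its
  capacities, so the truncated subtraction is exact. Capacities only shrink, hence passed arcs
  remain useless and the pointers can be kept.\<close>

lemma binv_augment:
  assumes I: "binv M lmt u cap0 D0 k0 start0 ptr cap path start weight k pos v q btl"
    and e: "e < m" "tail G e = v" "0 < cap e" "head G e = t"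
    and M: "drops M lmt cap0"
    and path': "path' = path(q := e)" and btl': "btl' = min btl (cap e)"
    and cap': "cap' = (\<lambda>x. if x \<in> set (map path' [pos..<Suc q]) then cap x - btl' else cap x)"
  shows "binv M lmt u cap0 D0 k0 start0 ptr cap' path' (start(Suc k := Suc q)) (weight(k := u))
      (Suc k) (Suc q) s (Suc q) lmt"
    and "M cap' < M cap" and "distinct (map path' [pos..<Suc q])"
    and "\<forall>x\<in>set (map path' [pos..<Suc q]). x < m"
proof -
  define p where "p = map path' [pos..<Suc q]"
  have pq: "pos \<le> q" by (rule binvD(6)[OF I])
  then have p: "p = map path [pos..<q] @ [e]" by (simp add: p_def path')
  have "awalk s p t"
    using binvD(7)[OF I] e by (auto simp: p awalk_Cons_iff awalk_Nil_iff arc_iff)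
  then have ap: "apath s p t" by (rule awalk_imp_apath)
  show dist: "distinct (map path' [pos..<Suc q])" using apath_distinct[OF ap] by (simp add: p_def)
  have pm: "\<forall>x\<in>set p. x < m" using \<open>awalk s p t\<close> by (auto simp: awalk_def arc_iff)
  then show "\<forall>x\<in>set (map path' [pos..<Suc q]). x < m" by (simp add: p_def)
  have btl: "1 \<le> btl'" "btl' \<le> lmt" "\<forall>x\<in>set p. btl' \<le> cap x" "btl' = lmt \<or> (\<exists>x\<in>set p. cap x = btl')"
    using binvD(8-11)[OF I] e(3) by (auto simp: btl' p min_def)
  have cap': "cap' = (\<lambda>x. if x \<in> set p then cap x - btl' else cap x)" by (simp add: cap' p_def)
  obtain D where D: "\<forall>(p, a)\<in>set D. apath s p t \<and> 1 \<le> a \<and> a \<le> lmt"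
     "\<forall>e<m. cap0 e = cap e + path_sum D e" "output_list path start weight k = D0 @ map (\<lambda>(p, a). (p, u)) D"
    using binvD(13)[OF I] by (elim conjE exE) (rule that)
  show less: "M cap' < M cap"
    unfolding cap' by (rule M[unfolded drops_def, rule_format, OF _ ap btl(1) _ btl(4)])
      (use D(2) btl(3) in auto)
  have o: "output_list path' (start(Suc k := Suc q)) (weight(k := u)) (Suc k)
      = D0 @ map (\<lambda>(p, a). (p, u)) (D @ [(p, btl')])"
  proof -
    have 1: "output_list path' (start(Suc k := Suc q)) (weight(k := u)) (Suc k)
      = output_list path' start weight k @ [(map path' [pos..<Suc q], u)]"
      by (rule output_list_append[where start = start and k = k, OF binvD(17)[OF I]])
    have 2: "output_list path' start weight k = output_list path start weight k"
      unfolding path' by (rule output_list_path_upd[where start = start and k = k, OF binvD(18)[OF I] binvD(6)[OF I]])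
    show ?thesis unfolding 1 2 D(3) p_def by simp
  qed
  have sum: "\<forall>e<m. cap0 e = cap' e + path_sum (D @ [(p, btl')]) e"
    using D(2) btl(3) by (auto simp: cap')
  have ex: "\<exists>D. (\<forall>(p, a)\<in>set D. apath s p t \<and> 1 \<le> a \<and> a \<le> lmt) \<and>
        (\<forall>e<m. cap0 e = cap' e + path_sum D e) \<and>
        output_list path' (start(Suc k := Suc q)) (weight(k := u)) (Suc k) = D0 @ map (\<lambda>(p, a). (p, u)) D"
    using D(1) ap btl(1,2) sum o by (intro exI[of _ "D @ [(p, btl')]"]) auto
  \<comment> \<open>Each recorded path has fewer than \<open>n\<close> arcs, so \<open>k\<close> of
    them occupy at most \<open>k * n\<close> cells.\<close>
  have "length p < n" by (rule awalk_length_less[OF \<open>awalk s p t\<close>])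
  then have "Suc q - pos < n" unfolding p_def by (simp only: length_map length_upt)
  moreover have "pos \<le> k * n" by (rule binvD(19)[OF I])
  ultimately have pos': "Suc q \<le> Suc k * n" using pq by simp
  have passed: "\<forall>e<m. e < ptr (tail G e) \<longrightarrow> cap' e = 0 \<or> ptr (head G e) = m"
    using binvD(12)[OF I] by (auto simp: cap')
  have k: "k0 \<le> k" "k + M cap \<le> k0 + M cap0" "\<forall>i\<le>k0. start i = start0 i" "\<forall>i\<le>k. start i \<le> pos"
    "\<forall>w<n. ptr w \<le> m" "ptr t = 0" "1 \<le> lmt"
    using binvD(14,15,16,18,4,5,9,10)[OF I] by simp_all
  show "binv M lmt u cap0 D0 k0 start0 ptr cap' path' (start(Suc k := Suc q)) (weight(k := u))
      (Suc k) (Suc q) s (Suc q) lmt"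
    unfolding binv_def
  proof (intro conjI)
    show "\<forall>i\<le>Suc k. (start(Suc k := Suc q)) i \<le> Suc q"
      using k(4) pq by (auto simp: le_Suc_eq intro: le_trans)
  qed (use ex passed k less pos' s_less source_neq_sink source(1) in \<open>simp_all add: awalk_Nil_iff\<close>)
qed

text \<open>The exhausted vertices form the blocking set. Their pointers have passed every arc, so
  an arc leaving the set is empty; the pointer of the sink is \<open>0 < m\<close>, which keeps
  \<open>t\<close> out.\<close>

lemma binv_blocked:
  assumes "binv M lmt u cap0 D0 k0 start0 ptr cap path start weight k pos v q btl" "\<not> ptr s < m"
  shows "blocked cap"
proof -
  let ?R = "{v. v < n \<and> ptr v = m}"
  have "ptr s = m" "s < n" "ptr t = 0" and passed: "\<forall>e<m. e < ptr (tail G e) \<longrightarrow> cap e = 0 \<or> ptr (head G e) = m"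
    using binvD(4,5,12)[OF assms(1)] assms(2) s_less by (simp_all add: le_antisym)
  moreover have "m > 0" using card_arcs_ge by simp
  moreover have "cap e = 0" if "e \<in> leaving ?R" for e
    using that passed head_less by (auto simp: leaving_def arc_iff)
  ultimately show ?thesis
    unfolding blocked_def by (intro exI[of _ ?R]) (auto simp: vert_iff)
qed

section \<open>Amortized cost of a step of the walk\<close>

abbreviation block_inv where
  "block_inv M lmt cap0 D0 k0 start0 u \<rho> \<equiv>
     binv M lmt u cap0 D0 k0 start0 (arr \<rho> ''ptr'') (arr \<rho> ''cap'') (arr \<rho> ''path'')
       (arr \<rho> ''start'') (arr \<rho> ''weight'') (reg \<rho> ''k'') (reg \<rho> ''pos'')
       (reg \<rho> ''v'') (reg \<rho> ''q'') (reg \<rho> ''bot'')"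

text \<open>The last term pays for pushes, 100 for each arc by which the walk may still grow.
  Restoring it takes at most \<open>100 * n\<close>, which comes from \<open>scan_pot\<close> when a
  vertex is exhausted and from the drop of \<open>M\<close> after an augmentation; the other
  \<open>200 * n\<close> of that drop pay for the pass along the path.\<close>

definition block_pot :: "((nat \<Rightarrow> nat) \<Rightarrow> nat) \<Rightarrow> state \<Rightarrow> nat" where
  "block_pot M \<rho> = 100 * scan_pot (arr \<rho> ''ptr'') + 300 * (n * M (arr \<rho> ''cap''))
     + 100 * (n - (reg \<rho> ''q'' - reg \<rho> ''pos''))"

definition net_state :: "nat \<Rightarrow> state \<Rightarrow> bool" where
  "net_state B \<rho> \<longleftrightarrow>
     reg \<rho> ''n'' = n \<and> reg \<rho> ''m'' = m \<and> reg \<rho> ''s'' = s \<and> reg \<rho> ''t'' = t \<and>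
     (\<forall>e<m. arr \<rho> ''tail'' e = tail G e) \<and> (\<forall>e<m. arr \<rho> ''head'' e = head G e) \<and>
     n < B \<and> m + 2 \<le> B"

lemma net_stateD:
  assumes "net_state B \<rho>"
  shows "reg \<rho> ''n'' = n" "reg \<rho> ''m'' = m" "reg \<rho> ''s'' = s" "reg \<rho> ''t'' = t"
    "e < m \<Longrightarrow> arr \<rho> ''tail'' e = tail G e" "e < m \<Longrightarrow> arr \<rho> ''head'' e = head G e"
    "n < B" "m + 2 \<le> B" "m < B" "Suc 0 < B" "s < B" "t < B" "0 < B"
  using assms s_less t_less card_verts_ge by (simp_all add: net_state_def)

text \<open>The surplus 5 is the price of the loop guard. The product bounding \<open>B\<close>
  covers the index \<open>q\<close> into \<open>path\<close>: at most \<open>k0 + M cap0\<close>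
  recorded paths and the current walk, each with fewer than \<open>n\<close> arcs.\<close>

lemma walk_step_runs:
  assumes I: "block_inv M lmt cap0 D0 k0 start0 u \<rho>"
    and N: "net_state B \<rho>" and lmt: "reg \<rho> ''lim'' = lmt" and u: "reg \<rho> ''u'' = u"
    and M: "drops M lmt cap0" and cap0: "\<forall>e<m. cap0 e < B"
    and B: "(k0 + M cap0 + 2) * (n + 2) \<le> B" "lmt < B" "u < B"
    and ptr_s: "arr \<rho> ''ptr'' s < m"
  shows "runs B walk_step \<rho> (\<lambda>T \<tau>. block_inv M lmt cap0 D0 k0 start0 u \<tau> \<and>
     block_pot M \<tau> + T + 5 \<le> block_pot M \<rho>)"
proof -
  define v ptr cap where "v = reg \<rho> ''v''" and "ptr = arr \<rho> ''ptr''" and "cap = arr \<rho> ''cap''"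
  define path start weight where "path = arr \<rho> ''path''" and "start = arr \<rho> ''start''"
    and "weight = arr \<rho> ''weight''"
  define k pos q btl where "k = reg \<rho> ''k''" and "pos = reg \<rho> ''pos''" and "q = reg \<rho> ''q''"
    and "btl = reg \<rho> ''bot''"
  define e where "e = ptr v"
  note vals = v_def[symmetric] ptr_def[symmetric] cap_def[symmetric] path_def[symmetric]
    start_def[symmetric] weight_def[symmetric] k_def[symmetric] pos_def[symmetric]
    q_def[symmetric] btl_def[symmetric]
  have I: "binv M lmt u cap0 D0 k0 start0 ptr cap path start weight k pos v q btl"
    using I by (simp add: vals)
  note D = binvD[OF I]
  have vm: "ptr v < m" using D(3) ptr_s by (auto simp: ptr_def)
  then have em: "e < m" by (simp add: e_def)
  have ht: "tail G e < n" "head G e < n" using em by (simp_all add: tail_less head_less)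
  have capB: "cap x < B" if "x < m" for x
    using D(13) cap0 that by (metis le_add1 le_less_trans)
  have ptrB: "ptr w < B" if "w < n" for w
    using D(4) that net_stateD(8)[OF N] by fastforce
  have len: "q - pos < n" by (rule binv_length[OF I])
  have K: "k \<le> k0 + M cap0" using D(15) by simp
  then have "k * n \<le> (k0 + M cap0) * n" by (rule mult_le_mono1)
  then have qB: "q < B" "Suc q < B" "k < B" "Suc k < B" "pos < B"
    using D(6,19) B(1) len K by (simp_all add: algebra_simps)
  have bd: "v < B" "e < B" "btl < B" "tail G e < B" "head G e < B" "cap e < B" "ptr (head G e) < B" "Suc e < B"
    using D(1,10) em ht net_stateD(7,8)[OF N] B(2) capB[OF em] ptrB[of "head G e"] by simp_all
  note env = net_stateD[OF N] vals bd lmt u qB B(2,3) e_def[symmetric] ht em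
  define post where "post c = (\<lambda>T \<tau>. block_inv M lmt cap0 D0 k0 start0 u \<tau> \<and>
     block_pot M \<tau> + T + c \<le> block_pot M \<rho>)" for c
  define \<rho>0 where "\<rho>0 = \<rho>\<lparr>reg := (reg \<rho>)(''e'' := e)\<rparr>"
  define taken where "taken \<longleftrightarrow> tail G e = v \<and> 0 < cap e \<and> ptr (head G e) < m"
  \<comment> \<open>Reading the pointer and testing the arc cost 20 units, so both branches must
    leave 25 for 5 to remain.\<close>
  have step: "runs B walk_step \<rho> (post 5)"
    if push: "taken \<Longrightarrow> runs B push_step \<rho>0 (post 25)"
      and advance: "\<not> taken \<Longrightarrow> runs B advance_step \<rho>0 (post 25)"
  proof -
    have \<rho>0: "\<rho>\<lparr>reg := (reg \<rho>)(''e'' := aval (Cell ''ptr'' (Reg ''v'')) \<rho>)\<rparr> = \<rho>0"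
      by (simp add: \<rho>0_def vals e_def)
    show ?thesis
      unfolding walk_step_def runs_Seq runs_Assign runs_Cond \<rho>0
    proof (intro conjI impI, goal_cases)
      case 1
      show ?case by (simp add: env)
    next
      case 2
      show ?case by (simp add: \<rho>0_def env)
    next
      case 3
      then have taken by (simp add: \<rho>0_def env taken_def)
      show ?case by (rule runs_mono[OF push[OF \<open>taken\<close>]]) (simp add: post_def)
    next
      case 4
      then have "\<not> taken" by (simp add: \<rho>0_def env taken_def)
      show ?case by (rule runs_mono[OF advance[OF \<open>\<not> taken\<close>]]) (simp add: post_def)
    qed
  qed
  have "runs B advance_step \<rho>0 (post 25)" if not: "\<not> taken"
  proof -
    note adv = binv_advance[OF I vm not[unfolded taken_def e_def], folded e_def]
    have pot: "scan_pot (ptr(v := Suc e)) + 1 + (if Suc e = m then n else 0) = scan_pot ptr"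
      using scan_pot_upd[of v ptr] D(1) vm by (simp add: e_def)
    show ?thesis
    proof (cases "Suc e = m")
      case True
      have "100 * n \<le> 100 * (n - (q - pos)) + 100 * n" by simp
      then show ?thesis
        using adv(2) pot True
        by (simp add: advance_step_def restart_def \<rho>0_def env block_pot_def post_def)
    next
      case False
      then show ?thesis
        using adv(1) pot em
        by (simp add: advance_step_def \<rho>0_def env block_pot_def post_def)
    qed
  qed
  moreover have "runs B push_step \<rho>0 (post 25)" if push: taken
  proof -
    define path' btl' where "path' = path(q := e)" and "btl' = min btl (cap e)"
    have btlB: "btl' < B" using bd by (simp add: btl'_def)
    define \<rho>1 where "\<rho>1 = \<rho>\<lparr>arr := (arr \<rho>)(''path'' := path'),
       reg := (reg \<rho>)(''e'' := e, ''q'' := Suc q, ''v'' := head G e, ''bot'' := btl')\<rparr>"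
    have btl': "cap e < btl \<Longrightarrow> btl' = cap e" "\<not> cap e < btl \<Longrightarrow> btl' = btl"
      by (simp_all add: btl'_def)
    \<comment> \<open>If the bottleneck stays, writing \<open>btl'\<close> to \<open>bot\<close>
      changes nothing, so both branches of the conditional end in \<open>\<rho>1\<close>.\<close>
    have \<rho>1: "\<rho>1 = \<rho>\<lparr>arr := (arr \<rho>)(''path'' := path'),
       reg := (reg \<rho>)(''e'' := e, ''q'' := Suc q, ''v'' := head G e)\<rparr>" if "\<not> cap e < btl"
    proof -
      have "(reg \<rho>)(''e'' := e, ''q'' := Suc q, ''v'' := head G e, ''bot'' := btl')
          = (reg \<rho>)(''e'' := e, ''q'' := Suc q, ''v'' := head G e)"
        using btl'(2)[OF that] by (simp add: fun_eq_iff btl_def)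
      then show ?thesis by (simp only: \<rho>1_def)
    qed
    have taken: "tail G e = v" "0 < cap e" "ptr (head G e) < m"
      using push by (simp_all add: taken_def)
    show ?thesis
    proof (cases "head G e = t")
      case False
      have "binv M lmt u cap0 D0 k0 start0 ptr cap path' start weight k pos (head G e) (Suc q) btl'"
        unfolding path'_def btl'_def by (rule binv_push[OF I em taken False])
      then have "post 25 T \<rho>1" if "T \<le> 70" for T
        using that len D(6) by (simp add: post_def \<rho>1_def env block_pot_def)
      then show ?thesis
        using False by (cases "cap e < btl")
          (simp add: push_step_def env \<rho>0_def \<rho>1_def btl' path'_def,
           simp add: push_step_def env \<rho>0_def \<rho>1 path'_def)
    next
      case sink: True
      define cap' where "cap' = (\<lambda>x. if x \<in> set (map path' [pos..<Suc q]) then cap x - btl' else cap x)"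
      note aug = binv_augment[OF I em taken(1,2) sink M path'_def btl'_def cap'_def]
      have sub: "runs B subtract_along \<rho>1 (\<lambda>T \<tau>.
          (\<exists>j. \<tau> = \<rho>1\<lparr>reg := (reg \<rho>1)(''j'' := j), arr := (arr \<rho>1)(''cap'' := cap')\<rparr>) \<and>
          T \<le> 20 * (Suc q - pos) + 10)"
      proof -
        have bounds: "arr \<rho>1 ''path'' i < B \<and> arr \<rho>1 ''cap'' (arr \<rho>1 ''path'' i) < B"
          if "pos \<le> i" "i < Suc q" for i
        proof -
          have "path' i \<in> set (map path' [pos..<Suc q])" using that by (simp del: upt_Suc)
          then have "path' i < m" using aug(4) by blast
          then show ?thesis using capB[of "path' i"] net_stateD(8)[OF N] by (simp add: \<rho>1_def vals)
        qed
        have regs: "reg \<rho>1 ''pos'' = pos" "reg \<rho>1 ''q'' = Suc q" "reg \<rho>1 ''bot'' = btl'"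
          "arr \<rho>1 ''path'' = path'" "arr \<rho>1 ''cap'' = cap"
          by (simp_all add: \<rho>1_def vals)
        show ?thesis
          using subtract_along_runs[of \<rho>1 B, unfolded regs] bounds[unfolded regs]
            qB btlB net_stateD(10)[OF N] D(6) aug(3)
          unfolding cap'_def by simp
      qed
      \<comment> \<open>The rest of \<open>push_step\<close> costs at most 75 units; with the 25
        required of the branch this makes 100.\<close>
      have aug_run: "runs B augment \<rho>1 (post 100)"
        unfolding augment_def runs_Seq
      proof (rule runs_mono[OF sub], goal_cases)
        case (1 T \<tau>)
        then obtain j where \<tau>: "\<tau> = \<rho>1\<lparr>reg := (reg \<rho>1)(''j'' := j), arr := (arr \<rho>1)(''cap'' := cap')\<rparr>"
          and T: "T \<le> 20 * (Suc q - pos) + 10" by blast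
        have "n * Suc (M cap') \<le> n * M cap" using aug(2) by (intro mult_le_mono2) simp
        then have "n * M cap' + n \<le> n * M cap" by simp
        moreover have "T \<le> 20 * n + 10" using T len by simp
        ultimately show ?case
          using aug(1) card_verts_ge
          by (simp add: record_path_def restart_def \<tau> \<rho>1_def env block_pot_def post_def)
      qed
      have "runs B augment \<rho>1 (\<lambda>T. post 25 (g T))" if "\<And>T. g T \<le> 75 + T" for g
      proof (rule runs_mono[OF aug_run])
        fix T \<tau> assume "post 100 T \<tau>"
        then show "post 25 (g T) \<tau>" using that[of T] by (simp add: post_def)
      qed
      then show ?thesis
        using sink by (cases "cap e < btl")
          (simp add: push_step_def env \<rho>0_def \<rho>1_def btl' path'_def,
           simp add: push_step_def env \<rho>0_def \<rho>1 path'_def)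
    qed
  qed
  ultimately show ?thesis using step by (simp add: post_def)
qed
end

lemma written_walk_step:
  "written_regs walk_step = {''e'', ''q'', ''v'', ''bot'', ''j'', ''k'', ''pos''}"
  "written_arrs walk_step = {''path'', ''cap'', ''weight'', ''start'', ''ptr''}"
  by (auto simp: walk_step_def push_step_def advance_step_def augment_def subtract_along_def
      record_path_def restart_def)

lemma written_blocking:
  "written_regs blocking = {''e'', ''q'', ''v'', ''bot'', ''j'', ''k'', ''pos''}"
  "written_arrs blocking = {''path'', ''cap'', ''weight'', ''start'', ''ptr''}"
  by (auto simp: blocking_def restart_def written_walk_step)

text \<open>The facts on the recorded output that are handed from one search to the next. The last
  clause bounds the used cells of \<open>path\<close> through the number of paths.\<close>

definition out_ok :: "nat \<Rightarrow> state \<Rightarrow> bool" where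
  "out_ok N \<sigma> \<longleftrightarrow> arr \<sigma> ''start'' (reg \<sigma> ''k'') = reg \<sigma> ''pos'' \<and>
     (\<forall>i\<le>reg \<sigma> ''k''. arr \<sigma> ''start'' i \<le> reg \<sigma> ''pos'') \<and> reg \<sigma> ''pos'' \<le> reg \<sigma> ''k'' * N"

section \<open>Cost and outcome of a complete search\<close>

context numbered_network begin

lemma net_state_framed:
  assumes "net_state B \<sigma>" "framed c \<sigma> \<rho>" "written_regs c \<inter> {''n'', ''m'', ''s'', ''t''} = {}"
    "written_arrs c \<inter> {''tail'', ''head''} = {}"
  shows "net_state B \<rho>"
proof -
  have "reg \<rho> ''n'' = reg \<sigma> ''n''" "reg \<rho> ''m'' = reg \<sigma> ''m''" "reg \<rho> ''s'' = reg \<sigma> ''s''"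
    "reg \<rho> ''t'' = reg \<sigma> ''t''"
    by (rule framed_reg[OF assms(2)], use assms(3) in blast)+
  moreover have "arr \<rho> ''tail'' = arr \<sigma> ''tail''" "arr \<rho> ''head'' = arr \<sigma> ''head''"
    by (rule framed_arr[OF assms(2)], use assms(4) in blast)+
  ultimately show ?thesis using assms(1) by (simp add: net_state_def)
qed

lemma scan_pot_le: "scan_pot ptr \<le> n * (m + n)"
proof -
  have "scan_pot ptr \<le> (\<Sum>w<n. m + n)" unfolding scan_pot_def by (intro sum_mono) auto
  then show ?thesis by simp
qed

lemma reset_loop_runs:
  assumes N: "net_state B \<sigma>" and v: "reg \<sigma> ''v'' = 0"
  shows "runs B (While (Less (Reg ''v'') (Reg ''n'')) (Store ''ptr'' (Reg ''v'') (Const 0) ;; incr ''v'')) \<sigma>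
    (\<lambda>T \<tau>. (\<forall>w<n. arr \<tau> ''ptr'' w = 0) \<and>
       (\<forall>x. x \<noteq> ''v'' \<longrightarrow> reg \<tau> x = reg \<sigma> x) \<and> (\<forall>a. a \<noteq> ''ptr'' \<longrightarrow> arr \<tau> a = arr \<sigma> a) \<and>
       T \<le> 20 * n + 10)" (is "runs B (While ?b ?c) \<sigma> ?Q")
proof (rule runs_While[where I = "\<lambda>\<rho>. reg \<rho> ''v'' \<le> n \<and> (\<forall>w<reg \<rho> ''v''. arr \<rho> ''ptr'' w = 0)"
      and V = "\<lambda>\<rho>. 20 * (n - reg \<rho> ''v'')"], goal_cases)
  case 1
  show ?case using v by simp
next
  case (2 \<rho>)
  have "net_state B \<rho>" by (rule net_state_framed[OF N 2(2)]) auto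
  then show ?case using 2(1) net_stateD[of B \<rho>] by simp
next
  case (3 \<rho>)
  have "net_state B \<rho>" by (rule net_state_framed[OF N 3(2)]) auto
  then show ?case using 3(1,3) net_stateD[of B \<rho>] by (auto simp: less_Suc_eq)
next
  case (4 T \<tau>)
  have "net_state B \<tau>" by (rule net_state_framed[OF N 4(2)]) auto
  then have "reg \<tau> ''v'' = n" using 4(1,3) net_stateD(1)[of B \<tau>] by simp
  then show ?case using 4 v by (simp add: framed_def)
qed

text \<open>\<open>D\<close> lists the paths with the amounts sent, while the output carries them
  with weight \<open>u\<close>. The search for \<open>g\<close> needs the amounts, the unit search
  also the output. The clause on \<open>start\<close> allows the new paths to be discarded
  afterwards.\<close>

lemma blocking_runs:
  assumes N: "net_state B \<sigma>" and lmt: "reg \<sigma> ''lim'' = lmt" and u: "reg \<sigma> ''u'' = u"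
    and cap0: "arr \<sigma> ''cap'' = cap0" "\<forall>e<m. cap0 e < B" and M: "drops M lmt cap0"
    and B: "(reg \<sigma> ''k'' + M cap0 + 2) * (n + 2) \<le> B" "lmt < B" "1 \<le> lmt" "u < B"
    and out: "out_ok n \<sigma>"
  shows "runs B blocking \<sigma> (\<lambda>T \<tau>. \<exists>D.
     (\<forall>(p, a)\<in>set D. apath s p t \<and> 1 \<le> a \<and> a \<le> lmt) \<and>
     (\<forall>e<m. cap0 e = arr \<tau> ''cap'' e + path_sum D e) \<and>
     program_output \<tau> = program_output \<sigma> @ map (\<lambda>(p, a). (p, u)) D \<and>
     blocked (arr \<tau> ''cap'') \<and> out_ok n \<tau> \<and> length D \<le> M cap0 \<and>
     reg \<tau> ''k'' = reg \<sigma> ''k'' + length D \<and>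
     (\<forall>i\<le>reg \<sigma> ''k''. arr \<tau> ''start'' i = arr \<sigma> ''start'' i) \<and>
     T \<le> 1000 * (n * (m + M cap0)))"
proof -
  define k0 start0 D0 where "k0 = reg \<sigma> ''k''" and "start0 = arr \<sigma> ''start''"
    and "D0 = program_output \<sigma>"
  define post where "post T \<tau> \<longleftrightarrow> (\<exists>D.
     (\<forall>(p, a)\<in>set D. apath s p t \<and> 1 \<le> a \<and> a \<le> lmt) \<and>
     (\<forall>e<m. cap0 e = arr \<tau> ''cap'' e + path_sum D e) \<and>
     program_output \<tau> = D0 @ map (\<lambda>(p, a). (p, u)) D \<and>
     blocked (arr \<tau> ''cap'') \<and> out_ok n \<tau> \<and> length D \<le> M cap0 \<and>
     reg \<tau> ''k'' = k0 + length D \<and>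
     (\<forall>i\<le>k0. arr \<tau> ''start'' i = start0 i) \<and>
     T \<le> 1000 * (n * (m + M cap0)))" for T \<tau>
  have n2: "2 \<le> n" "1 \<le> m" "n \<le> m + 1" using card_verts_ge card_arcs_ge card_verts_le by auto
  have kB: "k0 < B" "reg \<sigma> ''pos'' < B"
    using B(1) out by (auto simp: k0_def out_ok_def algebra_simps)
  \<comment> \<open>\<open>g\<close> stands for the time including the commands before the loop,
    mainly the reset of the pointers.\<close>
  have "runs B (While (Less (Cell ''ptr'' (Reg ''s'')) (Reg ''m'')) walk_step) \<rho> (\<lambda>T. post (g T))"
    if init: "\<forall>w<n. arr \<rho> ''ptr'' w = 0" "net_state B \<rho>" "reg \<rho> ''lim'' = lmt" "reg \<rho> ''u'' = u"
        "arr \<rho> ''cap'' = cap0" "arr \<rho> ''path'' = arr \<sigma> ''path''" "arr \<rho> ''start'' = start0"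
        "arr \<rho> ''weight'' = arr \<sigma> ''weight''" "reg \<rho> ''k'' = k0" "reg \<rho> ''pos'' = reg \<sigma> ''pos''"
        "reg \<rho> ''v'' = s" "reg \<rho> ''q'' = reg \<sigma> ''pos''" "reg \<rho> ''bot'' = lmt"
      and g: "\<And>T. g T \<le> 20 * n + 50 + T" for \<rho> g
  proof (rule runs_While[where I = "block_inv M lmt cap0 D0 k0 start0 u" and V = "block_pot M"], goal_cases)
    case 1
    have output_list: "output_list (arr \<sigma> ''path'') start0 (arr \<sigma> ''weight'') k0 = D0"
      by (simp add: D0_def start0_def k0_def program_output_eq)
    show ?case
      unfolding binv_def init output_list
    proof (intro conjI)
      show "\<exists>D. (\<forall>(p, a)\<in>set D. apath s p t \<and> 1 \<le> a \<and> a \<le> lmt) \<and>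
        (\<forall>e<m. cap0 e = cap0 e + path_sum D e) \<and> D0 = D0 @ map (\<lambda>(p, a). (p, u)) D"
        by (intro exI[of _ "[]"]) simp
    qed (use init(1) s_less t_less source_neq_sink source(1) B(3) out in
        \<open>simp_all add: awalk_Nil_iff tail_less out_ok_def k0_def start0_def\<close>)
  next
    case (2 \<rho>')
    have N': "net_state B \<rho>'"
      by (rule net_state_framed[OF init(2) 2(2)]) (simp_all add: written_walk_step)
    have "arr \<rho>' ''ptr'' s < B"
      using binvD(4)[OF 2(1)] s_less net_stateD(9)[OF N'] by (meson le_less_trans)
    then show ?case using net_stateD[OF N'] by simp
  next
    case (3 \<rho>')
    have N': "net_state B \<rho>'"
      by (rule net_state_framed[OF init(2) 3(2)]) (simp_all add: written_walk_step)
    have regs: "reg \<rho>' ''lim'' = lmt" "reg \<rho>' ''u'' = u"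
      using framed_reg[OF 3(2)] init by (simp_all add: written_walk_step)
    have "arr \<rho>' ''ptr'' s < m" using 3(3) net_stateD[OF N'] by simp
    then have "runs B walk_step \<rho>' (\<lambda>T \<tau>. block_inv M lmt cap0 D0 k0 start0 u \<tau> \<and>
       block_pot M \<tau> + T + 5 \<le> block_pot M \<rho>')"
      using 3(1) N' regs M cap0(2) B by (intro walk_step_runs) (simp_all add: k0_def)
    then show ?case by (rule runs_mono) simp
  next
    case (4 T \<tau>)
    have N': "net_state B \<tau>"
      by (rule net_state_framed[OF init(2) 4(2)]) (simp_all add: written_walk_step)
    have "\<not> arr \<tau> ''ptr'' s < m" using 4(3) net_stateD[OF N'] by simp
    then have bl: "blocked (arr \<tau> ''cap'')" by (rule binv_blocked[OF 4(1)])
    note I = binvD[OF 4(1)]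
    obtain D where D: "\<forall>(p, a)\<in>set D. apath s p t \<and> 1 \<le> a \<and> a \<le> lmt"
        "\<forall>e<m. cap0 e = arr \<tau> ''cap'' e + path_sum D e"
        "program_output \<tau> = D0 @ map (\<lambda>(p, a). (p, u)) D"
      using I(13)[folded program_output_eq] by (elim exE conjE) (rule that)
    have "length (program_output \<tau>) = reg \<tau> ''k''" "length D0 = k0"
      by (simp_all add: program_output_def D0_def k0_def)
    then have k: "reg \<tau> ''k'' = k0 + length D" using arg_cong[OF D(3), of length] by simp
    have len: "length D \<le> M cap0" using k I(15) by simp
    have "block_pot M \<rho> \<le> 100 * (n * (m + n)) + 300 * (n * M cap0) + 100 * n"
      using scan_pot_le[of "arr \<rho> ''ptr''"] by (simp add: block_pot_def init)
    moreover have "T \<le> block_pot M \<rho> + 5" using 4(4) by simp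
    ultimately have "g T \<le> 100 * (n * (m + n)) + 300 * (n * M cap0) + 120 * n + 55"
      using g[of T] by simp
    also have "\<dots> \<le> 1000 * (n * (m + M cap0))"
    proof -
      \<comment> \<open>Here \<open>n \<le> m + 1 \<le> 2 * m\<close> removes the term quadratic in
        \<open>n\<close>.\<close>
      have "n * n \<le> n * (m + m)" "n * 1 \<le> n * m" using n2 by (intro mult_le_mono2; simp)+
      then show ?thesis using n2 unfolding distrib_left by linarith
    qed
    finally have "g T \<le> 1000 * (n * (m + M cap0))" .
    then show ?case
      unfolding post_def out_ok_def
      using D bl k len I(16-19) by (intro exI[of _ D]) simp
  qed
  note main = this
  have "runs B blocking \<sigma> post"
    unfolding blocking_def runs_Seq runs_Assign
  proof (intro conjI, goal_cases)
    case 1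
    show ?case using net_stateD[OF N] by simp
  next
    case 2
    have N': "net_state B (\<sigma>\<lparr>reg := (reg \<sigma>)(''v'' := aval (Const 0) \<sigma>)\<rparr>)"
      using N by (simp add: net_state_def)
    show ?case
    proof (rule runs_mono[OF reset_loop_runs[OF N']], goal_cases)
      case 1
      show ?case by simp
    next
      case (2 T \<rho>)
      have N2: "net_state B \<rho>" using 2 N by (simp add: net_state_def)
      have regs: "reg \<rho> ''s'' = s" "reg \<rho> ''pos'' = reg \<sigma> ''pos''" "reg \<rho> ''lim'' = lmt"
        using 2 net_stateD[OF N] lmt by simp_all
      let ?\<rho> = "\<rho>\<lparr>reg := (reg \<rho>)(''v'' := s, ''q'' := reg \<sigma> ''pos'', ''bot'' := lmt)\<rparr>"
      have "runs B (While (Less (Cell ''ptr'' (Reg ''s'')) (Reg ''m'')) walk_step) ?\<rho> (\<lambda>T'. post (g T'))"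
        if "\<And>T. g T \<le> 20 * n + 50 + T" for g
        using 2 N2 that lmt u cap0(1) by (intro main) (simp_all add: net_state_def k0_def start0_def)
      then show ?case
        using 2 B(2) net_stateD(11)[OF N] kB
        by (simp add: restart_def regs)
    qed
  qed
  then show ?thesis unfolding post_def k0_def start0_def D0_def .
qed

end

section \<open>Halving the flow\<close>

definition halve_caps :: com where
  "halve_caps =
     Assign ''e'' (Const 0) ;;
     While (Less (Reg ''e'') (Reg ''m''))
       (Store ''cap'' (Reg ''e'') (Half (Cell ''flow'' (Reg ''e''))) ;; incr ''e'')"

text \<open>After the first search \<open>cap\<close> is the residual of the halved flow, so the
  difference recovers \<open>g\<close>. The remainder becomes the capacity of the second search, and
  \<open>g\<close> the flow of the next round.\<close>

definition split_flow :: com where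
  "split_flow =
     Assign ''e'' (Const 0) ;;
     While (Less (Reg ''e'') (Reg ''m''))
       (Assign ''g'' (Minus (Half (Cell ''flow'' (Reg ''e''))) (Cell ''cap'' (Reg ''e''))) ;;
        Store ''cap'' (Reg ''e'') (Minus (Cell ''flow'' (Reg ''e'')) (Plus (Reg ''g'') (Reg ''g''))) ;;
        Store ''flow'' (Reg ''e'') (Reg ''g'') ;;
        incr ''e'')"

text \<open>Run only once. Later \<open>mx\<close> is halved along with the flow; it stays an upper
  bound, though perhaps not the maximum, and fixes the number of rounds.\<close>

definition max_flow :: com where
  "max_flow =
     Assign ''e'' (Const 0) ;;
     While (Less (Reg ''e'') (Reg ''m''))
       (Cond (Less (Reg ''mx'') (Cell ''flow'' (Reg ''e''))) (Assign ''mx'' (Cell ''flow'' (Reg ''e''))) Skip ;;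
        incr ''e'')"

text \<open>
  The first search only serves to find \<open>g\<close>. Its paths are discarded by resetting \<open>k\<close> and \<open>pos\<close>.
\<close>

definition halving_round :: com where
  "halving_round =
     halve_caps ;;
     Assign ''lim'' (Reg ''mx'') ;; Assign ''k0'' (Reg ''k'') ;; Assign ''pos0'' (Reg ''pos'') ;;
     blocking ;;
     Assign ''k'' (Reg ''k0'') ;; Assign ''pos'' (Reg ''pos0'') ;;
     split_flow ;;
     Assign ''lim'' (Const 1) ;;
     blocking ;;
     Assign ''u'' (Plus (Reg ''u'') (Reg ''u'')) ;; Assign ''mx'' (Half (Reg ''mx''))"

section \<open>Measures for the number of augmentations\<close>

context numbered_network begin

text \<open>If the amount equals \<open>lmt\<close>, then the first arc of the path, whose capacity
  is at most \<open>lmt\<close>, is itself emptied. So in each case an arc becomes empty, and none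
  is refilled.\<close>

lemma drops_card:
  assumes "\<forall>e<m. cap0 e \<le> lmt"
  shows "drops (\<lambda>c. card {e \<in> arcs G. 0 < c e}) lmt cap0"
  unfolding drops_def
proof (intro allI impI)
  fix cap :: "nat \<Rightarrow> nat" and p :: "nat list" and a :: nat
  assume le: "\<forall>e<m. cap e \<le> cap0 e" and p: "apath s p t" and a: "1 \<le> a" "\<forall>e\<in>set p. a \<le> cap e"
    and at: "a = lmt \<or> (\<exists>e\<in>set p. cap e = a)"
  let ?cap = "\<lambda>e. if e \<in> set p then cap e - a else cap e"
  have arcs: "set p \<subseteq> arcs G" using p by (simp add: apath_def awalk_def)
  have "p \<noteq> []" using p source_neq_sink by (auto simp: apath_Nil_iff)
  then have "hd p \<in> set p" by simp
  moreover have "cap (hd p) \<le> lmt"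
    using le assms arcs \<open>hd p \<in> set p\<close> by (meson arc_iff le_trans subsetD)
  ultimately have "\<exists>e\<in>set p. cap e = a" using at a(2) by (metis le_antisym)
  then obtain e where e: "e \<in> set p" "cap e = a" by blast
  have "{e \<in> arcs G. 0 < ?cap e} \<subset> {e \<in> arcs G. 0 < cap e}"
  proof
    show "{e \<in> arcs G. 0 < ?cap e} \<subseteq> {e \<in> arcs G. 0 < cap e}" by auto
    have "e \<in> {e \<in> arcs G. 0 < cap e}" "e \<notin> {e \<in> arcs G. 0 < ?cap e}"
      using e a(1) arcs by auto
    then show "{e \<in> arcs G. 0 < ?cap e} \<noteq> {e \<in> arcs G. 0 < cap e}" by blast
  qed
  then show "card {e \<in> arcs G. 0 < ?cap e} < card {e \<in> arcs G. 0 < cap e}"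
    by (intro psubset_card_mono) simp_all
qed

text \<open>The first arc of the path leaves \<open>s\<close> and loses at least one unit.\<close>

lemma drops_val: "drops val lmt cap0"
  unfolding drops_def
proof (intro allI impI)
  fix cap :: "nat \<Rightarrow> nat" and p :: "nat list" and a :: nat
  assume p: "apath s p t" and a: "1 \<le> a" "\<forall>e\<in>set p. a \<le> cap e"
  let ?cap = "\<lambda>e. if e \<in> set p then cap e - a else cap e"
  have "p \<noteq> []" using p source_neq_sink by (auto simp: apath_Nil_iff)
  then obtain e q where "p = e # q" by (cases p) auto
  then have e: "e \<in> out_arcs G s" "e \<in> set p" using p by (auto simp: apath_Cons_iff)
  then have less: "?cap e < cap e" using a by fastforce
  show "val ?cap < val cap"
    unfolding val_def
  proof (rule sum_strict_mono_ex1)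
    show "\<exists>e\<in>out_arcs G s. ?cap e < cap e" using less e(1) by (rule bexI)
  qed (simp_all add: finite_out_arcs)
qed

section \<open>Passes over the arc arrays\<close>

lemma net_state_e:
  assumes "net_state B \<sigma>"
  shows "net_state B (\<sigma>\<lparr>reg := (reg \<sigma>)(''e'' := j)\<rparr>)"
  using assms by (simp add: net_state_def)

lemma halve_caps_runs:
  assumes N: "net_state B \<sigma>" and B: "\<forall>e<m. arr \<sigma> ''flow'' e < B"
  shows "runs B halve_caps \<sigma> (\<lambda>T \<tau>. (\<forall>e<m. arr \<tau> ''cap'' e = arr \<sigma> ''flow'' e div 2) \<and>
    framed halve_caps \<sigma> \<tau> \<and> T \<le> 40 * m + 20)"
proof -
  have "runs B halve_caps \<sigma> (\<lambda>T \<tau>. (\<forall>e<m. arr \<tau> ''cap'' e = arr \<sigma> ''flow'' e div 2) \<and> T \<le> 40 * m + 20)"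
    unfolding halve_caps_def runs_Seq runs_Assign
  proof (intro conjI, goal_cases)
    case 1
    show ?case using net_stateD[OF N] by simp
  next
    case 2
    show ?case
    proof (rule runs_While[where I = "\<lambda>\<rho>. reg \<rho> ''e'' \<le> m \<and>
          (\<forall>i<reg \<rho> ''e''. arr \<rho> ''cap'' i = arr \<sigma> ''flow'' i div 2)"
          and V = "\<lambda>\<rho>. 40 * (m - reg \<rho> ''e'')"], goal_cases)
      case 1
      show ?case by simp
    next
      case (2 \<rho>)
      have "net_state B \<rho>" by (rule net_state_framed[OF net_state_e[OF N] 2(2)[unfolded aval.simps]]) auto
      then show ?case using 2(1) net_stateD[of B \<rho>] by simp
    next
      case (3 \<rho>)
      have "net_state B \<rho>" by (rule net_state_framed[OF net_state_e[OF N] 3(2)[unfolded aval.simps]]) auto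
      moreover have "arr \<rho> ''flow'' = arr \<sigma> ''flow''" using framed_arr[OF 3(2)] by simp
      ultimately show ?case using 3(1,3) net_stateD[of B \<rho>] B by (auto simp: less_Suc_eq)
    next
      case (4 T \<tau>)
      have "net_state B \<tau>" by (rule net_state_framed[OF net_state_e[OF N] 4(2)[unfolded aval.simps]]) auto
      then have "reg \<tau> ''e'' = m" using 4(1,3) net_stateD(2)[of B \<tau>] by simp
      then show ?case using 4 by simp
    qed
  qed
  from runs_framed[OF this] show ?thesis by (rule runs_mono) simp
qed

lemma split_flow_runs:
  assumes N: "net_state B \<sigma>" and B: "\<forall>e<m. arr \<sigma> ''flow'' e < B \<and> arr \<sigma> ''cap'' e < B"
    and h: "h = arr \<sigma> ''flow''" and c: "c = arr \<sigma> ''cap''"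
  shows "runs B split_flow \<sigma> (\<lambda>T \<tau>.
    (\<forall>e<m. arr \<tau> ''flow'' e = h e div 2 - c e \<and> arr \<tau> ''cap'' e = h e - 2 * (h e div 2 - c e)) \<and>
    framed split_flow \<sigma> \<tau> \<and> T \<le> 80 * m + 20)"
proof -
  have "runs B split_flow \<sigma> (\<lambda>T \<tau>. (\<forall>e<m. arr \<tau> ''flow'' e = h e div 2 - c e \<and>
      arr \<tau> ''cap'' e = h e - 2 * (h e div 2 - c e)) \<and> T \<le> 80 * m + 20)"
    unfolding split_flow_def runs_Seq[of _ "Assign ''e'' _"] runs_Assign
  proof (intro conjI, goal_cases)
    case 1
    show ?case using net_stateD[OF N] by simp
  next
    case 2
    show ?case
    proof (rule runs_While[where I = "\<lambda>\<rho>. reg \<rho> ''e'' \<le> m \<and>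
          (\<forall>i<reg \<rho> ''e''. arr \<rho> ''flow'' i = h i div 2 - c i \<and>
             arr \<rho> ''cap'' i = h i - 2 * (h i div 2 - c i)) \<and>
          (\<forall>i\<ge>reg \<rho> ''e''. arr \<rho> ''flow'' i = h i \<and> arr \<rho> ''cap'' i = c i)"
          and V = "\<lambda>\<rho>. 80 * (m - reg \<rho> ''e'')"], goal_cases)
      case 1
      show ?case by (simp add: h c)
    next
      case (2 \<rho>)
      have "net_state B \<rho>" by (rule net_state_framed[OF net_state_e[OF N] 2(2)[unfolded aval.simps]]) auto
      then show ?case using 2(1) net_stateD[of B \<rho>] by simp
    next
      case (3 \<rho>)
      have N': "net_state B \<rho>" by (rule net_state_framed[OF net_state_e[OF N] 3(2)[unfolded aval.simps]]) auto
      define i where "i = reg \<rho> ''e''"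
      have i: "i < m" "i < B" "Suc i < B" using 3(3) net_stateD[OF N'] by (simp_all add: i_def)
      have hc: "arr \<rho> ''flow'' i = h i" "arr \<rho> ''cap'' i = c i" "h i < B" "c i < B"
        using 3(1) i B by (simp_all add: i_def h c)
      have g: "h i div 2 - c i < B" "h i div 2 - c i + (h i div 2 - c i) < B" "h i div 2 < B"
        using hc(3) by linarith+
      have nx: "\<forall>j\<ge>Suc i. arr \<rho> ''flow'' j = h j \<and> arr \<rho> ''cap'' j = c j"
        "\<forall>j<i. arr \<rho> ''flow'' j = h j div 2 - c j \<and> arr \<rho> ''cap'' j = h j - 2 * (h j div 2 - c j)"
        using 3(1) by (simp_all add: i_def)
      show ?case
        using i hc g nx net_stateD(10)[OF N']
        by (simp add: i_def[symmetric] less_Suc_eq all_conj_distrib mult_2)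
    next
      case (4 T \<tau>)
      have "net_state B \<tau>" by (rule net_state_framed[OF net_state_e[OF N] 4(2)[unfolded aval.simps]]) auto
      then have "reg \<tau> ''e'' = m" using 4(1,3) net_stateD(2)[of B \<tau>] by simp
      then show ?case using 4 by simp
    qed
  qed
  from runs_framed[OF this] show ?thesis by (rule runs_mono) simp
qed

lemma max_flow_runs:
  assumes N: "net_state B \<sigma>" and B: "\<forall>e<m. arr \<sigma> ''flow'' e < B"
    and f: "arr \<sigma> ''flow'' = f" and mx: "reg \<sigma> ''mx'' = 0"
  shows "runs B max_flow \<sigma> (\<lambda>T \<tau>. (\<forall>e<m. f e \<le> reg \<tau> ''mx'') \<and>
    (reg \<tau> ''mx'' = 0 \<or> (\<exists>e<m. reg \<tau> ''mx'' = f e)) \<and> framed max_flow \<sigma> \<tau> \<and> T \<le> 40 * m + 20)"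
proof -
  have "runs B max_flow \<sigma> (\<lambda>T \<tau>. (\<forall>e<m. f e \<le> reg \<tau> ''mx'') \<and>
    (reg \<tau> ''mx'' = 0 \<or> (\<exists>e<m. reg \<tau> ''mx'' = f e)) \<and> T \<le> 40 * m + 20)"
    unfolding max_flow_def runs_Seq[of _ "Assign ''e'' _"] runs_Assign
  proof (intro conjI, goal_cases)
    case 1
    show ?case using net_stateD[OF N] by simp
  next
    case 2
    show ?case
    proof (rule runs_While[where I = "\<lambda>\<rho>. reg \<rho> ''e'' \<le> m \<and> (\<forall>i<reg \<rho> ''e''. f i \<le> reg \<rho> ''mx'') \<and>
          (reg \<rho> ''mx'' = 0 \<or> (\<exists>i<m. reg \<rho> ''mx'' = f i))"
          and V = "\<lambda>\<rho>. 40 * (m - reg \<rho> ''e'')"], goal_cases)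
      case 1
      show ?case by (simp add: mx)
    next
      case (2 \<rho>)
      have "net_state B \<rho>" by (rule net_state_framed[OF net_state_e[OF N] 2(2)[unfolded aval.simps]]) auto
      then show ?case using 2(1) net_stateD[of B \<rho>] by simp
    next
      case (3 \<rho>)
      have N': "net_state B \<rho>" by (rule net_state_framed[OF net_state_e[OF N] 3(2)[unfolded aval.simps]]) auto
      have fl: "arr \<rho> ''flow'' = f" using framed_arr[OF 3(2)] f by simp
      define i where "i = reg \<rho> ''e''"
      have i: "i < m" "i < B" "Suc i < B" using 3(3) net_stateD[OF N'] by (simp_all add: i_def)
      have mxB: "reg \<rho> ''mx'' < B" using 3(1) B f net_stateD(13)[OF N'] by auto
      show ?case
        using i mxB net_stateD(10)[OF N'] 3(1) B f
        by (auto simp: i_def[symmetric] fl less_Suc_eq intro: le_trans less_imp_le)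
    next
      case (4 T \<tau>)
      have "net_state B \<tau>" by (rule net_state_framed[OF net_state_e[OF N] 4(2)[unfolded aval.simps]]) auto
      then have "reg \<tau> ''e'' = m" using 4(1,3) net_stateD(2)[of B \<tau>] by simp
      then show ?case using 4 by simp
    qed
  qed
  from runs_framed[OF this] show ?thesis by (rule runs_mono) simp
qed

text \<open>Relates amounts to recorded weights: if all amounts are 1, recording \<open>u\<close>
  instead scales the sum by \<open>u\<close>.\<close>

lemma path_sum_unit:
  assumes "\<forall>(p, a)\<in>set D. a = 1"
  shows "path_sum (map (\<lambda>(p, a). (p, u)) D) e = u * path_sum D e"
  using assms by (induction D) (auto simp: algebra_simps)

lemma out_ok_reset:
  assumes "out_ok N \<sigma>" "reg \<tau> ''k'' = reg \<sigma> ''k''" "reg \<tau> ''pos'' = reg \<sigma> ''pos''"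
    "\<forall>i\<le>reg \<sigma> ''k''. arr \<tau> ''start'' i = arr \<sigma> ''start'' i"
  shows "out_ok N \<tau>"
  using assms by (simp add: out_ok_def)

section \<open>Correctness of one halving round\<close>

lemma written_loops:
  "written_regs halve_caps = {''e''}" "written_arrs halve_caps = {''cap''}"
  "written_regs split_flow = {''e'', ''g''}" "written_arrs split_flow = {''cap'', ''flow''}"
  "written_regs max_flow = {''e'', ''mx''}" "written_arrs max_flow = {}"
  by (auto simp: halve_caps_def split_flow_def max_flow_def)

text \<open>\<open>D\<close> accounts for \<open>u\<close> times the remainder
  \<open>h - 2 g\<close>, so replacing \<open>h\<close> by \<open>g\<close> is matched by doubling
  \<open>u\<close>. The bound on \<open>B\<close> leaves room for \<open>m\<close> new paths in
  either search.\<close>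

lemma halving_round_runs:
  assumes N: "net_state B \<sigma>" and h: "arr \<sigma> ''flow'' = h" "is_flow G s t h"
    and mx: "reg \<sigma> ''mx'' = mx" "1 \<le> mx" "mx < B" "\<forall>e<m. h e \<le> mx"
    and u: "reg \<sigma> ''u'' = u" "2 * u < B"
    and B: "(reg \<sigma> ''k'' + m + 2) * (n + 2) \<le> B" and out: "out_ok n \<sigma>"
  shows "runs B halving_round \<sigma> (\<lambda>T \<tau>. \<exists>D.
     (\<forall>(p, w)\<in>set D. apath s p t) \<and>
     program_output \<tau> = program_output \<sigma> @ D \<and>
     length D \<le> parallel_width G s t \<and>
     (\<forall>e<m. u * h e = 2 * u * arr \<tau> ''flow'' e + path_sum D e) \<and>
     is_flow G s t (arr \<tau> ''flow'') \<and> (\<forall>e<m. arr \<tau> ''flow'' e \<le> mx div 2) \<and>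
     reg \<tau> ''u'' = 2 * u \<and> reg \<tau> ''mx'' = mx div 2 \<and> out_ok n \<tau> \<and> net_state B \<tau> \<and>
     T \<le> 5000 * (n * m))"
proof -
  define k0 pos0 D0 where "k0 = reg \<sigma> ''k''" and "pos0 = reg \<sigma> ''pos''" and "D0 = program_output \<sigma>"
  define post where "post T \<tau> \<longleftrightarrow> (\<exists>D.
     (\<forall>(p, w)\<in>set D. apath s p t) \<and>
     program_output \<tau> = D0 @ D \<and>
     length D \<le> parallel_width G s t \<and>
     (\<forall>e<m. u * h e = 2 * u * arr \<tau> ''flow'' e + path_sum D e) \<and>
     is_flow G s t (arr \<tau> ''flow'') \<and> (\<forall>e<m. arr \<tau> ''flow'' e \<le> mx div 2) \<and>
     reg \<tau> ''u'' = 2 * u \<and> reg \<tau> ''mx'' = mx div 2 \<and> out_ok n \<tau> \<and> net_state B \<tau> \<and>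
     T \<le> 5000 * (n * m))" for T \<tau>
  have post_mono: "post x \<tau> \<Longrightarrow> y \<le> x \<Longrightarrow> post y \<tau>" for x y \<tau>
    unfolding post_def by (elim exE, intro exI, elim conjE, intro conjI; (assumption | simp))
  have hB: "\<forall>e<m. h e < B" using mx(3,4) by (meson le_less_trans)
  have kB: "k0 < B" "pos0 < B"
    using B out by (auto simp: k0_def pos0_def out_ok_def algebra_simps)
  have lens: "length (program_output \<tau>) = reg \<tau> ''k''" for \<tau> by (simp add: program_output_def)
  have nm: "2 \<le> n" "1 \<le> m" "n * m \<ge> 2 * m" using card_verts_ge card_arcs_ge by simp_all

  \<comment> \<open>The round is verified from its end; \<open>T'\<close> is the time already spent
    when this suffix starts.\<close>
  have second: "runs B (blocking ;; Assign ''u'' (Plus (Reg ''u'') (Reg ''u'')) ;; Assign ''mx'' (Half (Reg ''mx''))) \<rho>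
      (\<lambda>T. post (T' + T))"
    if N': "net_state B \<rho>" and D1: "\<forall>(p, w)\<in>set D1. apath s p t"
      and c1: "blocked c1" "\<forall>e<m. h e div 2 = c1 e + path_sum D1 e"
      and fl: "\<forall>e<m. arr \<rho> ''flow'' e = h e div 2 - c1 e \<and> arr \<rho> ''cap'' e = h e - 2 * (h e div 2 - c1 e)"
      and regs: "reg \<rho> ''u'' = u" "reg \<rho> ''mx'' = mx" "reg \<rho> ''lim'' = 1" "reg \<rho> ''k'' = k0"
      and out': "out_ok n \<rho>" "program_output \<rho> = D0"
      and T': "T' \<le> 2000 * (n * m) + 120 * m + 100"
    for \<rho> D1 c1 T'
  proof -
    define c2 where "c2 = arr \<rho> ''cap''"
    have g: "arr \<rho> ''flow'' e = path_sum D1 e" "h e = c2 e + 2 * path_sum D1 e" if "e < m" for e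
    proof -
      show "arr \<rho> ''flow'' e = path_sum D1 e" using c1(2) fl that by simp
      have "h e div 2 - c1 e = path_sum D1 e" "path_sum D1 e \<le> h e div 2" using c1(2) that by simp_all
      then show "h e = c2 e + 2 * path_sum D1 e" using fl that by (simp add: c2_def)
    qed
    have c2_flow: "is_flow G s t c2"
      by (rule is_flow_add_path_sum[where c = 2, OF D1 _ h(2)]) (simp add: arc_iff g(2))
    have c2_le: "c2 e \<le> 1" if "e \<in> arcs G" "c1 e = 0" for e
    proof -
      \<comment> \<open>Where the residual \<open>c1\<close> is exhausted, \<open>g\<close> is the
        full half of \<open>h\<close>, and \<open>c2\<close> is the parity of
        \<open>h\<close>.\<close>
      have "c2 e = h e - 2 * (h e div 2)" using fl that by (simp add: c2_def arc_iff)
      then show ?thesis by linarith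
    qed
    have val: "val c2 \<le> parallel_width G s t"
      by (rule val_le_parallel_width[OF c2_flow c1(1) c2_le])
    then have valm: "val c2 \<le> m" using parallel_width_le by simp
    have "(k0 + val c2 + 2) * (n + 2) \<le> (k0 + m + 2) * (n + 2)"
      using valm by (intro mult_le_mono1) simp
    then have B': "(reg \<rho> ''k'' + val c2 + 2) * (n + 2) \<le> B" using B regs by (simp add: k0_def)
    have c2B: "\<forall>e<m. c2 e < B" using hB g(2) by (metis le_add1 le_less_trans)
    have uB: "u < B" "1 < B" using u net_stateD(10)[OF N'] by simp_all
    note run = blocking_runs[where M = val and ?cap0.0 = c2, OF N' regs(3,1) c2_def[symmetric] c2B drops_val B' uB(2) _ uB(1) out'(1)]
    show ?thesis
      unfolding runs_Seq[of _ blocking]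
    proof (rule runs_mono[OF runs_framed[OF run]], goal_cases)
      case 1
      show ?case by simp
    next
      case (2 T \<tau>)
      then obtain D where D: "\<forall>(p, a)\<in>set D. apath s p t \<and> 1 \<le> a \<and> a \<le> 1"
          "\<forall>e<m. c2 e = arr \<tau> ''cap'' e + path_sum D e"
          "program_output \<tau> = program_output \<rho> @ map (\<lambda>(p, a). (p, u)) D"
          "blocked (arr \<tau> ''cap'')" "out_ok n \<tau>" "length D \<le> val c2"
          "T \<le> 1000 * (n * (m + val c2))"
        and fr: "framed blocking \<rho> \<tau>" by (elim conjE exE) (rule that)
      have unit: "\<forall>(p, a)\<in>set D. a = 1" and paths: "\<forall>(p, a)\<in>set D. apath s p t"
        using D(1) by auto
      \<comment> \<open>The residual of the unit search is a flow and is blocked, so it vanishes and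
        the unit paths sum up to \<open>c2\<close>.\<close>
      have "is_flow G s t (arr \<tau> ''cap'')"
        by (rule is_flow_add_path_sum[where c = 1, OF paths _ c2_flow]) (use D(2) in \<open>simp add: arc_iff\<close>)
      then have "arr \<tau> ''cap'' e = 0" if "e < m" for e
        using blocked_flow_zero[OF _ D(4)] that by (simp add: arc_iff)
      then have c2_sum: "c2 e = path_sum D e" if "e < m" for e using D(2) that by simp
      have flow: "arr \<tau> ''flow'' = arr \<rho> ''flow''" using framed_arr[OF fr] by (simp add: written_blocking)
      have regs': "reg \<tau> ''u'' = u" "reg \<tau> ''mx'' = mx"
        using framed_reg[OF fr] regs by (simp_all add: written_blocking)
      have N\<tau>: "net_state B \<tau>"
        by (rule net_state_framed[OF N' fr]) (simp_all add: written_blocking)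
      define E where "E = map (\<lambda>(p, a). (p, u)) D"
      have E: "\<forall>(p, w)\<in>set E. apath s p t" "length E \<le> parallel_width G s t"
          "program_output \<tau> = D0 @ E"
        using paths D(3,6) val out'(2) by (auto simp: E_def)
      have sum: "u * h e = 2 * u * arr \<tau> ''flow'' e + path_sum E e" if "e < m" for e
        using g[OF that] c2_sum[OF that]
        by (simp add: E_def path_sum_unit[OF unit] flow algebra_simps)
      \<comment> \<open>\<open>g\<close> is conserved as the sum of the paths of the first search,
        although these are no longer in the output.\<close>
      have gflow: "is_flow G s t (arr \<tau> ''flow'')"
        unfolding is_flow_def
      proof
        fix v assume "v \<in> verts G - {s, t}"
        then have "(\<Sum>e\<in>in_arcs G v. path_sum D1 e) = (\<Sum>e\<in>out_arcs G v. path_sum D1 e)"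
          by (intro path_sum_conserved[OF D1]) auto
        moreover have "(\<Sum>e\<in>in_arcs G v. arr \<tau> ''flow'' e) = (\<Sum>e\<in>in_arcs G v. path_sum D1 e)"
          by (rule sum.cong) (simp_all add: flow g(1) arc_iff)
        moreover have "(\<Sum>e\<in>out_arcs G v. arr \<tau> ''flow'' e) = (\<Sum>e\<in>out_arcs G v. path_sum D1 e)"
          by (rule sum.cong) (simp_all add: flow g(1) arc_iff)
        ultimately show "(\<Sum>e\<in>in_arcs G v. arr \<tau> ''flow'' e) = (\<Sum>e\<in>out_arcs G v. arr \<tau> ''flow'' e)"
          by simp
      qed
      have gle: "\<forall>e<m. arr \<tau> ''flow'' e \<le> mx div 2"
      proof (intro allI impI)
        fix e assume "e < m"
        then have "arr \<tau> ''flow'' e = h e div 2 - c1 e" "h e \<le> mx" using fl flow mx(4) by simp_all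
        then show "arr \<tau> ''flow'' e \<le> mx div 2" using div_le_mono[of "h e" mx 2] by linarith
      qed
      have "n * (m + val c2) \<le> n * (m + m)" using valm by (intro mult_le_mono2) simp
      then have T: "T' + (T + c) \<le> 5000 * (n * m)" if "c \<le> 100" for c
        using D(7) T' that nm unfolding distrib_left by linarith
      let ?\<tau> = "\<tau>\<lparr>reg := (reg \<tau>)(''u'' := 2 * u, ''mx'' := mx div 2)\<rparr>"
      have "post x ?\<tau>" if "x \<le> 5000 * (n * m)" for x
        unfolding post_def
        using E sum gflow gle N\<tau> D(5) that
        by (intro exI[of _ E]) (simp add: program_output_eq out_ok_def net_state_def)
      then have "post x ?\<tau>" if "x \<le> T' + (T + 100)" for x using T[of 100] that by simp
      then show ?case using uB u(2) mx(3) by (simp add: regs' mult_2)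
    qed
  qed
  have first: "runs B (split_flow ;; Assign ''lim'' (Const 1) ;; blocking ;;
      Assign ''u'' (Plus (Reg ''u'') (Reg ''u'')) ;; Assign ''mx'' (Half (Reg ''mx''))) \<rho> (\<lambda>T. post (T' + T))"
    if N': "net_state B \<rho>" and D1: "\<forall>(p, w)\<in>set D1. apath s p t"
      and c1: "blocked (arr \<rho> ''cap'')" "\<forall>e<m. h e div 2 = arr \<rho> ''cap'' e + path_sum D1 e"
      and fl: "arr \<rho> ''flow'' = h"
      and regs: "reg \<rho> ''u'' = u" "reg \<rho> ''mx'' = mx" "reg \<rho> ''k'' = k0"
      and out': "out_ok n \<rho>" "program_output \<rho> = D0"
      and T': "T' \<le> 2000 * (n * m) + 40 * m + 60"
    for \<rho> D1 T'
  proof -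
    have "\<forall>e<m. arr \<rho> ''flow'' e < B \<and> arr \<rho> ''cap'' e < B"
    proof (intro allI impI)
      fix e assume e: "e < m"
      then have "arr \<rho> ''cap'' e \<le> h e div 2" using c1(2) by simp
      then have "arr \<rho> ''cap'' e \<le> h e" by simp
      then show "arr \<rho> ''flow'' e < B \<and> arr \<rho> ''cap'' e < B" using hB e fl by (auto intro: le_less_trans)
    qed
    note run = split_flow_runs[OF N' this fl[symmetric] refl]
    show ?thesis
      unfolding runs_Seq[of _ split_flow] runs_Seq[of _ "Assign ''lim'' _"] runs_Assign
    proof (rule runs_mono[OF run], intro conjI, goal_cases)
      case (1 T \<tau>)
      show ?case using net_stateD(10)[OF N'] by simp
    next
      case (2 T \<tau>)
      let ?\<tau> = "\<tau>\<lparr>reg := (reg \<tau>)(''lim'' := aval (Const 1) \<tau>)\<rparr>"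
      from 2 have fr: "framed split_flow \<rho> \<tau>" by blast
      have same: "arr \<tau> ''path'' = arr \<rho> ''path''" "arr \<tau> ''start'' = arr \<rho> ''start''"
        "arr \<tau> ''weight'' = arr \<rho> ''weight''" "reg \<tau> ''k'' = reg \<rho> ''k''"
        "reg \<tau> ''pos'' = reg \<rho> ''pos''" "reg \<tau> ''u'' = reg \<rho> ''u''" "reg \<tau> ''mx'' = reg \<rho> ''mx''"
        using framed_reg[OF fr] framed_arr[OF fr] by (simp_all add: written_loops)
      have "net_state B \<tau>" by (rule net_state_framed[OF N' fr]) (simp_all add: written_loops)
      then have N\<tau>: "net_state B ?\<tau>" by (simp add: net_state_def)
      have "out_ok n ?\<tau>" by (rule out_ok_reset[OF out'(1)]) (simp_all add: same)
      moreover have "program_output ?\<tau> = D0" using out'(2) by (simp add: program_output_eq same)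
      moreover have "T' + (T + 5) \<le> 2000 * (n * m) + 120 * m + 100" using 2 T' by simp
      ultimately have "runs B (blocking ;; Assign ''u'' (Plus (Reg ''u'') (Reg ''u'')) ;;
          Assign ''mx'' (Half (Reg ''mx''))) ?\<tau> (\<lambda>x. post (T' + (T + 5) + x))"
        using 2 by (intro second[OF N\<tau> D1 c1]) (simp_all add: same regs)
      then show ?case by (rule runs_mono) (erule post_mono, simp)
    qed
  qed
  have "runs B halving_round \<sigma> post"
    unfolding halving_round_def runs_Seq[of _ halve_caps]
  proof (rule runs_mono[OF halve_caps_runs[OF N]], goal_cases)
    case 1
    show ?case using hB h(1) by simp
  next
    case (2 T1 \<sigma>1)
    then have fr1: "framed halve_caps \<sigma> \<sigma>1" and cap1: "\<forall>e<m. arr \<sigma>1 ''cap'' e = h e div 2"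
      and T1: "T1 \<le> 40 * m + 20" by (simp_all add: h(1))
    define c0 where "c0 = arr \<sigma>1 ''cap''"
    have same1: "arr \<sigma>1 ''path'' = arr \<sigma> ''path''" "arr \<sigma>1 ''start'' = arr \<sigma> ''start''"
      "arr \<sigma>1 ''weight'' = arr \<sigma> ''weight''" "arr \<sigma>1 ''flow'' = h" "reg \<sigma>1 ''k'' = k0"
      "reg \<sigma>1 ''pos'' = pos0" "reg \<sigma>1 ''u'' = u" "reg \<sigma>1 ''mx'' = mx"
      using framed_reg[OF fr1] framed_arr[OF fr1] h(1) u mx
      by (simp_all add: written_loops k0_def pos0_def)
    define \<sigma>2 where "\<sigma>2 = \<sigma>1\<lparr>reg := (reg \<sigma>1)(''lim'' := mx, ''k0'' := k0, ''pos0'' := pos0)\<rparr>"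
    have "net_state B \<sigma>1" by (rule net_state_framed[OF N fr1]) (simp_all add: written_loops)
    then have N2: "net_state B \<sigma>2" by (simp add: net_state_def \<sigma>2_def)
    have same2: "arr \<sigma>2 ''start'' = arr \<sigma> ''start''" "arr \<sigma>2 ''cap'' = c0"
      "arr \<sigma>2 ''flow'' = h" "reg \<sigma>2 ''k'' = k0" "reg \<sigma>2 ''lim'' = mx"
      "reg \<sigma>2 ''k0'' = k0" "reg \<sigma>2 ''pos0'' = pos0"
      "reg \<sigma>2 ''pos'' = pos0" "reg \<sigma>2 ''u'' = u" "reg \<sigma>2 ''mx'' = mx"
      by (simp_all add: \<sigma>2_def same1 c0_def)
    have out2: "out_ok n \<sigma>2"
      by (rule out_ok_reset[OF out]) (simp_all add: same2 k0_def pos0_def)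
    have po2: "program_output \<sigma>2 = D0"
      by (simp add: D0_def program_output_eq \<sigma>2_def same1 k0_def)
    define M where "M c = card {e \<in> arcs G. 0 < c e}" for c :: "nat \<Rightarrow> nat"
    have M: "drops M mx c0"
      unfolding M_def using cap1 mx(4) by (intro drops_card) (auto simp: c0_def intro: le_trans[OF div_le_dividend])
    have Mm: "M c0 \<le> m" unfolding M_def by (intro card_mono) auto
    have c0B: "\<forall>e<m. c0 e < B" using cap1 hB by (auto simp: c0_def intro: le_less_trans[OF div_le_dividend])
    have "(k0 + M c0 + 2) * (n + 2) \<le> (k0 + m + 2) * (n + 2)"
      using Mm by (intro mult_le_mono1) simp
    then have B': "(reg \<sigma>2 ''k'' + M c0 + 2) * (n + 2) \<le> B" using B by (simp add: k0_def same2)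
    have uB: "u < B" using u by simp
    note run = blocking_runs[where M = M and ?cap0.0 = c0, OF N2 same2(5,9,2) c0B M B' mx(3,2) uB out2]
    have rest: "runs B (blocking ;; Assign ''k'' (Reg ''k0'') ;; Assign ''pos'' (Reg ''pos0'') ;;
        split_flow ;; Assign ''lim'' (Const 1) ;; blocking ;;
        Assign ''u'' (Plus (Reg ''u'') (Reg ''u'')) ;; Assign ''mx'' (Half (Reg ''mx''))) \<sigma>2
        (\<lambda>T. post (T1 + 20 + T))"
      unfolding runs_Seq[of _ blocking] runs_Seq[of _ "Assign _ (Reg _)"] runs_Assign
    proof (rule runs_mono[OF runs_framed[OF run]], goal_cases)
      case (1 T \<sigma>3)
      then obtain D1 where D1: "\<forall>(p, a)\<in>set D1. apath s p t \<and> 1 \<le> a \<and> a \<le> mx"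
          "\<forall>e<m. c0 e = arr \<sigma>3 ''cap'' e + path_sum D1 e"
          "program_output \<sigma>3 = program_output \<sigma>2 @ map (\<lambda>(p, a). (p, u)) D1"
          "blocked (arr \<sigma>3 ''cap'')"
          "\<forall>i\<le>reg \<sigma>2 ''k''. arr \<sigma>3 ''start'' i = arr \<sigma>2 ''start'' i"
          "reg \<sigma>3 ''k'' = reg \<sigma>2 ''k'' + length D1"
          "T \<le> 1000 * (n * (m + M c0))"
        and fr: "framed blocking \<sigma>2 \<sigma>3" by (elim conjE exE) (rule that)
      have same3: "arr \<sigma>3 ''flow'' = h" "reg \<sigma>3 ''k0'' = k0" "reg \<sigma>3 ''pos0'' = pos0"
          "reg \<sigma>3 ''u'' = u" "reg \<sigma>3 ''mx'' = mx"
        using framed_reg[OF fr] framed_arr[OF fr] same2 by (simp_all add: written_blocking)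
      define \<sigma>4 where "\<sigma>4 = \<sigma>3\<lparr>reg := (reg \<sigma>3)(''k'' := k0, ''pos'' := pos0)\<rparr>"
      have "net_state B \<sigma>3"
        by (rule net_state_framed[OF N2 fr]) (simp_all add: written_blocking)
      then have N4: "net_state B \<sigma>4" by (simp add: net_state_def \<sigma>4_def)
      have paths: "\<forall>(p, w)\<in>set D1. apath s p t" using D1(1) by auto
      have cap4: "arr \<sigma>4 ''cap'' = arr \<sigma>3 ''cap''" by (simp add: \<sigma>4_def)
      have out4: "out_ok n \<sigma>4"
        by (rule out_ok_reset[OF out2]) (use D1(5) same2 in \<open>simp_all add: \<sigma>4_def\<close>)
      \<comment> \<open>Lowering \<open>k\<close> truncates the output, and all paths of the first
        search stand behind its first \<open>k0\<close> entries.\<close>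
      have "program_output \<sigma>4 = take k0 (program_output \<sigma>3)"
        using D1(6) same2 by (simp add: program_output_def \<sigma>4_def take_map)
      also have "\<dots> = D0"
        unfolding D1(3) po2 using lens[of \<sigma>] by (simp add: D0_def k0_def)
      finally have po4: "program_output \<sigma>4 = D0" .
      have "n * (m + M c0) \<le> n * (m + m)" using Mm by (intro mult_le_mono2) simp
      then have T4: "T1 + 20 + (T + c) \<le> 2000 * (n * m) + 40 * m + 60" if "c \<le> 20" for c
        using D1(7) T1 that unfolding distrib_left by linarith
      have "runs B (split_flow ;; Assign ''lim'' (Const 1) ;; blocking ;;
          Assign ''u'' (Plus (Reg ''u'') (Reg ''u'')) ;; Assign ''mx'' (Half (Reg ''mx''))) \<sigma>4
          (\<lambda>x. post (T1 + 20 + (T + 7) + x))"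
      proof (rule first[OF N4 paths])
        show "\<forall>e<m. h e div 2 = arr \<sigma>4 ''cap'' e + path_sum D1 e"
          using D1(2) cap1 by (simp add: c0_def cap4)
      qed (use D1(4) out4 po4 T4[of 7] in \<open>simp_all add: cap4\<close>, simp_all add: \<sigma>4_def same3)
      note split = this
      have \<sigma>4: "\<sigma>3\<lparr>reg := (reg \<sigma>3)(''k'' := aval (Reg ''k0'') \<sigma>3)\<rparr>
          \<lparr>reg := (reg (\<sigma>3\<lparr>reg := (reg \<sigma>3)(''k'' := aval (Reg ''k0'') \<sigma>3)\<rparr>))
            (''pos'' := aval (Reg ''pos0'') (\<sigma>3\<lparr>reg := (reg \<sigma>3)(''k'' := aval (Reg ''k0'') \<sigma>3)\<rparr>))\<rparr> = \<sigma>4"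
        by (simp add: \<sigma>4_def same3)
      show ?case
        unfolding \<sigma>4
      proof (intro conjI)
        show "afits B (Reg ''k0'') \<sigma>3"
          "afits B (Reg ''pos0'') (\<sigma>3\<lparr>reg := (reg \<sigma>3)(''k'' := aval (Reg ''k0'') \<sigma>3)\<rparr>)"
          using kB by (simp_all add: same3)
      qed (rule runs_mono[OF split], erule post_mono, simp)
    qed
    have lim: "runs B (Assign ''lim'' (Reg ''mx'') ;; Assign ''k0'' (Reg ''k'') ;; Assign ''pos0'' (Reg ''pos'') ;; c) \<sigma>1 Q"
      if "runs B c \<sigma>2 (\<lambda>T. Q (9 + T))" for c Q
      using that kB mx(3) by (simp add: same1 \<sigma>2_def numeral_eq_Suc)
    show ?case
      by (rule lim, rule runs_mono[OF rest], erule post_mono, simp)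
  qed
  then show ?thesis unfolding post_def D0_def .
qed

end

section \<open>The decomposition algorithm\<close>

definition decompose_flow :: com where
  "decompose_flow =
     max_flow ;; Assign ''u'' (Const 1) ;; While (Less (Const 0) (Reg ''mx'')) halving_round"

text \<open>The number of halvings that turn \<open>x\<close> into 0, hence the number of rounds;
  the value at 0 lets the recursion hold down to \<open>x = 1\<close>.\<close>

definition num_bits :: "nat \<Rightarrow> nat" where
  "num_bits x = (if x = 0 then 0 else nat \<lfloor>log 2 (real x)\<rfloor> + 1)"

lemma num_bits_half:
  assumes "0 < x"
  shows "num_bits x = num_bits (x div 2) + 1"
proof (cases "x = 1")
  case False
  then have x: "2 \<le> x" using assms by simp
  then have pos: "0 < x div 2" by simp
  have "0 \<le> \<lfloor>log 2 (real (x div 2))\<rfloor>" using pos by simp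
  then show ?thesis using floor_log2_div2[OF x] x pos by (simp add: num_bits_def nat_add_distrib)
qed (simp add: num_bits_def)

text \<open>A crude bound that keeps the number of recorded paths below \<open>m * F\<close>, as the
  word capacity requires.\<close>

lemma num_bits_le: "num_bits x \<le> x"
proof (induction x rule: less_induct)
  case (less x)
  show ?case
  proof (cases "x = 0")
    case False
    then have "num_bits x = num_bits (x div 2) + 1" "num_bits (x div 2) \<le> x div 2"
      using less.IH num_bits_half by simp_all
    then show ?thesis using False by linarith
  qed (simp add: num_bits_def)
qed

section \<open>The rounds of the algorithm\<close>

context numbered_network begin

lemma is_flow_cong:
  assumes "is_flow G s t f" "\<And>e. e \<in> arcs G \<Longrightarrow> g e = f e"
  shows "is_flow G s t g"
  unfolding is_flow_def
proof
  fix v assume "v \<in> verts G - {s, t}"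
  then have "(\<Sum>e\<in>in_arcs G v. f e) = (\<Sum>e\<in>out_arcs G v. f e)" using assms(1) unfolding is_flow_def by blast
  moreover have "sum g (in_arcs G v) = sum f (in_arcs G v)" "sum g (out_arcs G v) = sum f (out_arcs G v)"
    by (intro sum.cong; simp add: assms(2))+
  ultimately show "sum g (in_arcs G v) = sum g (out_arcs G v)" by simp
qed

lemma decompose_flow_runs:
  assumes f: "is_flow G s t f" "\<forall>e \<in> arcs G. f e > 0" and F: "F = flow_norm G f"
    and B: "m + 2 \<le> B" "n < B" "2 * F < B" "(m * F + m + 2) * (n + 2) \<le> B"
  shows "runs B decompose_flow (input_state G s t f) (\<lambda>T \<tau>.
     flow_decomposition G s t f (program_output \<tau>) \<and>
     length (program_output \<tau>) \<le> parallel_width G s t * num_bits F \<and>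
     T \<le> 6000 * (n * m) * num_bits F + 40 * m + 50)"
proof -
  let ?pw = "parallel_width G s t" and ?\<sigma> = "input_state G s t f"
  define post where "post T \<tau> \<longleftrightarrow> flow_decomposition G s t f (program_output \<tau>) \<and>
     length (program_output \<tau>) \<le> ?pw * num_bits F \<and>
     T \<le> 6000 * (n * m) * num_bits F + 40 * m + 50" for T \<tau>
  have FB: "F < B" using B(3) by simp
  have fF: "f e \<le> F" if "e < m" for e
    unfolding F flow_norm_def using that by (intro Max_ge) (auto simp: arc_iff)
  have N: "net_state B ?\<sigma>"
    using B by (simp add: net_state_def input_state_def arc_iff)
  have flow0: "arr ?\<sigma> ''flow'' = (\<lambda>e. if e \<in> arcs G then f e else 0)"
    by (simp add: input_state_def)
  have nm: "2 \<le> n" "1 \<le> m" "n * m \<ge> 2 * m" using card_verts_ge card_arcs_ge by simp_all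
  have lens: "length (program_output \<tau>) = reg \<tau> ''k''" for \<tau> by (simp add: program_output_def)
  \<comment> \<open>\<open>u * mx \<le> F\<close> keeps the weights within the word capacity. The
    term with \<open>num_bits\<close> reserves one parallel-width of paths for each round left. In
    the last clause, \<open>u\<close> times the current flow is the part not yet decomposed.\<close>
  define I where "I \<rho> \<longleftrightarrow> net_state B \<rho> \<and> is_flow G s t (arr \<rho> ''flow'') \<and>
      (\<forall>e<m. arr \<rho> ''flow'' e \<le> reg \<rho> ''mx'') \<and> 1 \<le> reg \<rho> ''u'' \<and> reg \<rho> ''u'' * reg \<rho> ''mx'' \<le> F \<and>
      length (program_output \<rho>) + ?pw * num_bits (reg \<rho> ''mx'') \<le> ?pw * num_bits F \<and> out_ok n \<rho> \<and>
      (\<forall>(p, w)\<in>set (program_output \<rho>). apath s p t) \<and>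
      (\<forall>e<m. f e = reg \<rho> ''u'' * arr \<rho> ''flow'' e + path_sum (program_output \<rho>) e)" for \<rho>
  have loop: "runs B (While (Less (Const 0) (Reg ''mx'')) halving_round) \<rho> (\<lambda>T. post (g T))"
    if I0: "I \<rho>" "reg \<rho> ''mx'' = F" and g: "\<And>T. g T \<le> 40 * m + 40 + T" for \<rho> g
  proof (rule runs_While[where I = I and V = "\<lambda>\<rho>. 6000 * (n * m) * num_bits (reg \<rho> ''mx'')"], goal_cases)
    case 1
    show ?case by (rule I0)
  next
    case (2 \<rho>)
    then have "1 \<le> reg \<rho> ''u''" and le: "reg \<rho> ''u'' * reg \<rho> ''mx'' \<le> F" unfolding I_def by blast+
    then have "reg \<rho> ''mx'' \<le> reg \<rho> ''u'' * reg \<rho> ''mx''" by (cases "reg \<rho> ''u''") simp_all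
    then have "reg \<rho> ''mx'' \<le> F" using le by (rule le_trans)
    then show ?case using FB by simp
  next
    case (3 \<rho>)
    define mx u where "mx = reg \<rho> ''mx''" and "u = reg \<rho> ''u''"
    have I: "net_state B \<rho>" "is_flow G s t (arr \<rho> ''flow'')" "\<forall>e<m. arr \<rho> ''flow'' e \<le> mx" "1 \<le> u"
      "u * mx \<le> F" "length (program_output \<rho>) + ?pw * num_bits mx \<le> ?pw * num_bits F" "out_ok n \<rho>"
      "\<forall>(p, w)\<in>set (program_output \<rho>). apath s p t"
      "\<forall>e<m. f e = u * arr \<rho> ''flow'' e + path_sum (program_output \<rho>) e"
      using 3(1) unfolding I_def mx_def u_def by blast+
    have mx: "1 \<le> mx" using 3(3) by (simp add: mx_def)
    have "1 * mx \<le> u * mx" "u * 1 \<le> u * mx" using I(4) mx by (intro mult_le_mono; simp)+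
    then have le: "mx < B" "2 * u < B" using I(5) B(3) by linarith+
    have "?pw * num_bits F \<le> m * F" by (intro mult_le_mono parallel_width_le num_bits_le)
    then have "reg \<rho> ''k'' \<le> m * F" using I(6) lens[of \<rho>] by simp
    then have "(reg \<rho> ''k'' + m + 2) * (n + 2) \<le> (m * F + m + 2) * (n + 2)" by (intro mult_le_mono1) simp
    then have B': "(reg \<rho> ''k'' + m + 2) * (n + 2) \<le> B" using B(4) by simp
    have half: "num_bits mx = num_bits (mx div 2) + 1" using mx by (intro num_bits_half) simp
    show ?case
    proof (rule runs_mono[OF halving_round_runs[OF I(1) refl I(2) mx_def[symmetric] mx le(1) I(3) u_def[symmetric] le(2) B' I(7)]],
        goal_cases)
      case (1 T \<tau>)
      then obtain D where D: "\<forall>(p, w)\<in>set D. apath s p t" "program_output \<tau> = program_output \<rho> @ D"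
         "length D \<le> ?pw" "\<forall>e<m. u * arr \<rho> ''flow'' e = 2 * u * arr \<tau> ''flow'' e + path_sum D e"
         "is_flow G s t (arr \<tau> ''flow'')" "\<forall>e<m. arr \<tau> ''flow'' e \<le> mx div 2"
         "reg \<tau> ''u'' = 2 * u" "reg \<tau> ''mx'' = mx div 2" "out_ok n \<tau>" "net_state B \<tau>"
         "T \<le> 5000 * (n * m)" by (elim exE conjE) (rule that)
      have T: "4 + T \<le> 6000 * (n * m)" using D(11) nm by linarith
      have "2 * u * (mx div 2) = u * (2 * (mx div 2))" by simp
      also have "\<dots> \<le> u * mx" by (intro mult_le_mono2) simp
      finally have "2 * u * (mx div 2) \<le> F" using I(5) by (rule le_trans)
      moreover have "length (program_output \<tau>) + ?pw * num_bits (mx div 2) \<le> ?pw * num_bits F"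
        using D(2,3) I(6) half by (simp add: distrib_left)
      moreover have "\<forall>(p, w)\<in>set (program_output \<tau>). apath s p t" using D(1,2) I(8) by auto
      moreover have "\<forall>e<m. f e = 2 * u * arr \<tau> ''flow'' e + path_sum (program_output \<tau>) e"
        using I(9) D(2,4) by simp
      ultimately have "I \<tau>" unfolding I_def D(7,8) using D(5,6,9,10) I(4) by simp
      moreover have "6000 * (n * m) * num_bits (reg \<tau> ''mx'') + T + 1 + bcost (Less (Const 0) (Reg ''mx''))
          \<le> 6000 * (n * m) * num_bits (reg \<rho> ''mx'')"
        using T unfolding D(8) mx_def[symmetric] half by (simp add: distrib_left)
      ultimately show ?case by blast
    qed
  next
    case (4 T \<tau>)
    have I: "\<forall>e<m. arr \<tau> ''flow'' e \<le> reg \<tau> ''mx''"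
      "length (program_output \<tau>) + ?pw * num_bits (reg \<tau> ''mx'') \<le> ?pw * num_bits F"
      "\<forall>(p, w)\<in>set (program_output \<tau>). apath s p t"
      "\<forall>e<m. f e = reg \<tau> ''u'' * arr \<tau> ''flow'' e + path_sum (program_output \<tau>) e"
      using 4(1) unfolding I_def by blast+
    have "reg \<tau> ''mx'' = 0" using 4(3) by simp
    then have "flow_decomposition G s t f (program_output \<tau>)"
      unfolding flow_decomposition_iff using I by (simp add: arc_iff)
    moreover have "g T \<le> 6000 * (n * m) * num_bits F + 40 * m + 50"
      using 4(4) g[of T] I0(2) by simp
    ultimately show ?case using I(2) by (simp add: post_def)
  qed
  have "runs B decompose_flow ?\<sigma> post"
    unfolding decompose_flow_def runs_Seq[of _ max_flow]
  proof (rule runs_mono[OF max_flow_runs[OF N _ flow0]], goal_cases)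
    case 1
    show ?case using fF FB flow0 by (auto intro: le_less_trans)
  next
    case 2
    show ?case by (simp add: input_state_def)
  next
    case (3 T \<rho>)
    then have mx: "\<forall>e<m. f e \<le> reg \<rho> ''mx''" "reg \<rho> ''mx'' = 0 \<or> (\<exists>e<m. reg \<rho> ''mx'' = f e)"
      and fr: "framed max_flow ?\<sigma> \<rho>" and T: "T \<le> 40 * m + 20"
      by (auto simp: arc_iff)
    \<comment> \<open>Positivity of the flow excludes the value 0 with which \<open>mx\<close>
      starts.\<close>
    have "0 < f 0" "f 0 \<le> reg \<rho> ''mx''" using f(2) mx(1) nm by (simp_all add: arc_iff)
    then obtain e where "e < m" "reg \<rho> ''mx'' = f e" using mx(2) by auto
    then have "Max (f ` arcs G) = reg \<rho> ''mx''"
      using mx(1) by (intro Max_eqI) (auto simp: arc_iff)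
    then have mxF: "reg \<rho> ''mx'' = F" by (simp add: F flow_norm_def)
    let ?\<rho> = "\<rho>\<lparr>reg := (reg \<rho>)(''u'' := 1)\<rparr>"
    have "net_state B \<rho>" by (rule net_state_framed[OF N fr]) (simp_all add: written_loops)
    then have N': "net_state B ?\<rho>" by (simp add: net_state_def)
    have same: "arr \<rho> a = arr ?\<sigma> a" "reg \<rho> ''k'' = 0" "reg \<rho> ''pos'' = 0" for a
      using framed_reg[OF fr] framed_arr[OF fr] by (simp_all add: written_loops input_state_def)
    have po: "program_output ?\<rho> = []" by (simp add: program_output_def same)
    have "out_ok n ?\<rho>" by (simp add: out_ok_def same input_state_def)
    moreover have "is_flow G s t (arr ?\<rho> ''flow'')"
      by (rule is_flow_cong[OF f(1)]) (simp add: same flow0)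
    ultimately have "I ?\<rho>"
      unfolding I_def po using N' fF by (simp add: mxF same flow0 arc_iff)
    then have "runs B (While (Less (Const 0) (Reg ''mx'')) halving_round) ?\<rho> (\<lambda>T'. post (g T'))"
      if "\<And>T. g T \<le> 40 * m + 40 + T" for g
      by (rule loop) (use that mxF in simp_all)
    then show ?case using T net_stateD(10)[OF N] by simp
  qed
  then show ?thesis unfolding post_def .
qed

end

theorem theorem5:
  shows "\<exists>(prog :: com) (C :: real) (d :: nat).
    \<forall>(G :: (nat, nat) pre_digraph) (s :: nat) (t :: nat) (f :: nat \<Rightarrow> nat).
      st_dag G s t \<longrightarrow> numbered G \<longrightarrow> is_flow G s t f \<longrightarrow> (\<forall>e \<in> arcs G. f e > 0) \<longrightarrow>
      (\<exists>(T :: nat) (\<tau> :: state).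
         exec ((card (verts G) + card (arcs G) + flow_norm G f) ^ d) prog
           (input_state G s t f) T \<tau> \<and>
         flow_decomposition G s t f (program_output \<tau>) \<and>
         real (length (program_output \<tau>)) \<le>
           real (parallel_width G s t) / real (width G s t)
             * (real_of_int \<lfloor>log 2 (real (flow_norm G f))\<rfloor> + 1) * real (mfd G s t f) \<and>
         real T \<le> C * (real (card (verts G)) * max 1 (log 2 (real (flow_norm G f)))
             * (real (parallel_width G s t) + real (card (arcs G)))) \<and>
         (mfd G s t f \<ge> parallel_width G s t \<longrightarrow>
            real (length (program_output \<tau>)) \<le>
              (real_of_int \<lfloor>log 2 (real (flow_norm G f))\<rfloor> + 1) * real (mfd G s t f)))"
\<comment> \<open>The exponent 3 comes from \<open>(m * F + m + 2) * (n + 2)\<close>, which is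
  bounded by three factors of the input size. The constant 20000 exceeds
  \<open>6000 * 2 + 90\<close>, where the 2 pays for passing from the floor plus one to the maximum
  of 1 and the logarithm.\<close>
proof (rule exI[of _ decompose_flow], rule exI[of _ 20000], rule exI[of _ 3], intro allI impI)
  fix G :: "(nat, nat) pre_digraph" and s t :: nat and f :: "nat \<Rightarrow> nat"
  assume G: "st_dag G s t" "numbered G" and f: "is_flow G s t f" "\<forall>e \<in> arcs G. f e > 0"
  interpret numbered_network G s t using G by unfold_locales
  define F N where "F = flow_norm G f" and "N = n + m + F"
  define L where "L = real_of_int \<lfloor>log 2 (real F)\<rfloor> + 1"
  let ?pw = "parallel_width G s t"
  have nm: "2 \<le> n" "1 \<le> m" using card_verts_ge card_arcs_ge by simp_all
  have "f 0 \<le> F" unfolding F_def flow_norm_def using nm by (intro Max_ge) (auto simp: arc_iff)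
  moreover have "0 < f 0" using f(2) nm by (simp add: arc_iff)
  ultimately have F1: "1 \<le> F" by linarith
  have le: "m + 2 \<le> N" "n + 2 \<le> N" "F + 1 \<le> N" "F + 2 \<le> N" "4 \<le> N"
    using nm F1 by (simp_all add: N_def)
  have N3: "N ^ 3 = N * N * N" by (simp add: power3_eq_cube)
  have "N * N * 1 \<le> N * N * N" "4 * N \<le> N * N" using le(5) by (intro mult_le_mono; simp)+
  then have N_le: "4 * N \<le> N ^ 3" unfolding N3 by linarith
  have "m * F + m + 2 \<le> (m + 2) * (F + 1)" by simp
  also have "\<dots> \<le> N * N" using le by (intro mult_le_mono)
  finally have "(m * F + m + 2) * (n + 2) \<le> N ^ 3" unfolding N3 using le(2) by (rule mult_le_mono)
  then have B: "m + 2 \<le> N ^ 3" "n < N ^ 3" "2 * F < N ^ 3" "(m * F + m + 2) * (n + 2) \<le> N ^ 3"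
    using le N_le by linarith+
  obtain T \<tau> where run: "exec (N ^ 3) decompose_flow (input_state G s t f) T \<tau>"
    and dec: "flow_decomposition G s t f (program_output \<tau>)"
    and len: "length (program_output \<tau>) \<le> ?pw * num_bits F"
    and T: "T \<le> 6000 * (n * m) * num_bits F + 40 * m + 50"
    using decompose_flow_runs[OF f F_def B] by (auto elim: runsE)
  have log0: "0 \<le> log 2 (real F)" using F1 by simp
  have L: "real (num_bits F) = L" "1 \<le> L" using F1 log0 by (simp_all add: num_bits_def L_def)
  have lenL: "real (length (program_output \<tau>)) \<le> real ?pw * L"
    using of_nat_mono[OF len, where 'a = real] L(1) by simp
  have w: "0 < width G s t" "width G s t \<le> mfd G s t f"
    by (rule width_pos_le_mfd[OF dec f(2)])+
  \<comment> \<open>This factor turns the bound of one parallel-width per round into the stated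
    ratio.\<close>
  have "1 \<le> real (mfd G s t f) / real (width G s t)" using w by simp
  then have "real ?pw * L * 1 \<le> real ?pw * L * (real (mfd G s t f) / real (width G s t))"
    using L(2) by (intro mult_left_mono) simp_all
  then have ratio: "real (length (program_output \<tau>)) \<le> real ?pw / real (width G s t) * L * real (mfd G s t f)"
    using lenL by simp
  have large: "real (length (program_output \<tau>)) \<le> L * real (mfd G s t f)" if "?pw \<le> mfd G s t f"
  proof -
    have "real ?pw * L \<le> real (mfd G s t f) * L" using that L(2) by (intro mult_right_mono) simp_all
    then show ?thesis using lenL by (simp add: mult.commute)
  qed
  define X where "X = max 1 (log 2 (real F))"
  have X: "1 \<le> X" "L \<le> 2 * X" by (simp_all add: X_def L_def max_def) linarith+
  have "real T \<le> 20000 * (real n * X * (real ?pw + real m))"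
  proof -
    have "real T \<le> 6000 * (real n * real m) * L + 40 * real m + 50"
      using of_nat_mono[OF T, where 'a = real] L(1) by simp
    also have "\<dots> \<le> 6000 * (real n * real m) * (2 * X) + 90 * (real n * real m * X)"
    proof -
      have "real n * real m * L \<le> real n * real m * (2 * X)" using X(2) by (intro mult_left_mono) simp_all
      moreover have "1 * real m * 1 \<le> real n * real m * X" using nm X(1) by (intro mult_mono) simp_all
      moreover have "1 \<le> real m" using nm by simp
      ultimately show ?thesis by linarith
    qed
    also have "\<dots> \<le> 20000 * (real n * X * (real ?pw + real m))"
    proof -
      have "0 \<le> real n * X * real ?pw" "0 \<le> real n * X * real m" using X(1) by simp_all
      then show ?thesis by (simp add: algebra_simps)
    qed
    finally show ?thesis .
  qed
  then show "\<exists>T \<tau>.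
         exec ((n + m + flow_norm G f) ^ 3) decompose_flow (input_state G s t f) T \<tau> \<and>
         flow_decomposition G s t f (program_output \<tau>) \<and>
         real (length (program_output \<tau>)) \<le>
           real ?pw / real (width G s t)
             * (real_of_int \<lfloor>log 2 (real (flow_norm G f))\<rfloor> + 1) * real (mfd G s t f) \<and>
         real T \<le> 20000 * (real n * max 1 (log 2 (real (flow_norm G f)))
             * (real ?pw + real m)) \<and>
         (mfd G s t f \<ge> ?pw \<longrightarrow>
            real (length (program_output \<tau>)) \<le>
              (real_of_int \<lfloor>log 2 (real (flow_norm G f))\<rfloor> + 1) * real (mfd G s t f))"
    using run dec ratio large unfolding N_def L_def X_def F_def by blast
qed

end
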